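(* If $g$ is a $Q$-positive symmetric function, then $g$ is $\tilde\Xi$-positive. In particular, the chromatic symmetric function $\mathrm X_G$ of any graph $G$ and the Schur functions are $\tilde\Xi$-positive.
   Context: Symmetric functions are in countably many variables $x=(x_1,x_2,\dots)$, with rational coefficients. For a basis $\{u_\lambda\}$, a function $g$ is $u$-positive if the expansion of $g$ in terms of the basis has nonnegative coefficients; $Q$-positive refers to the expansion in the fundamental quasi-symmetric functions $$Q_S=Q_{S,d}(x)=\sum_{\substack{i_1\le\cdots\le i_d\\ i_j<i_{j+1}\text{ if }j\in S}}x_{i_1}x_{i_2}\cdots x_{i_d},\qquad S\subset[d-1]=\{1,\dots,d-1\}.$$ For an integer partition $\lambda$, $\tilde m_\lambda=(r_1!r_2!\cdots)m_\lambda$ where $r_i$ is the number of parts of $\lambda$ equal to $i$. $D_\lambda$ is the digraph which is a disjoint union of directed paths, the $i$th having $\lambda_i$ vertices. Every subset $F$ of the edges of $D_\lambda$ gives a spanning subgraph that is a disjoint union of directed paths (isolated vertices being paths with no edges); let $\pi(F)$ be the partition of the vertex set into the vertex sets of these paths and $\ell(\pi(F))$ their number. Then $$\tilde\Xi_\lambda=\sum_{F\subset E(D_\lambda)}\frac{\tilde m_{\pi(F)}}{\ell(\pi(F))!},$$ where a set partition in a subscript stands for the integer partition of its block sizes. The $\tilde\Xi_\lambda$ form a $\mathbb Q$-linear basis of the ring of symmetric functions. A graph is a finite simple undirected graph. A stable partition of $G$ is a partition of $V(G)$ such that no two vertices in the same block are adjacent. The chromatic symmetric function is $\mathrm X_G=\sum_\pi\tilde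 m_\pi(x)$, the sum over all stable partitions $\pi$ of $G$. *)

theory Defs
  imports
    "HOL-Library.Multiset"
    "HOL-Library.FuncSet"
    "HOL-Library.Disjoint_Sets"
    "Graph_Theory.Pair_Digraph"
begin

section \<open>Formal power series in countably many variables\<close>

text \<open>
  A monomial in the variables \<open>x\<^sub>0, x\<^sub>1, x\<^sub>2, \<dots>\<close> is the multiset of the indices of its
  factors, so the exponent of \<open>x\<^sub>i\<close> in \<open>M\<close> is \<open>count M i\<close>; a series is its coefficient
  function.  The variables are numbered from 0 instead of 1.
\<close>

type_synonym series = "nat multiset \<Rightarrow> rat"

definition symmetric_function :: "series \<Rightarrow> bool" where
  "symmetric_function g \<longleftrightarrow>
     (\<exists>d. \<forall>M. g M \<noteq> 0 \<longrightarrow> size M \<le> d) \<and>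
     (\<forall>p. bij p \<longrightarrow> (\<forall>M. g (image_mset p M) = g M))"

text \<open>
  The formal sum, over \<open>a \<in> A\<close>, of the monomials \<open>w a\<close>.  It is only used when every monomial
  arises from finitely many \<open>a\<close>, so the value of \<^const>\<open>card\<close> on infinite sets is irrelevant.
\<close>

definition monomial_sum :: "'i set \<Rightarrow> ('i \<Rightarrow> nat multiset) \<Rightarrow> series" where
  "monomial_sum A w = (\<lambda>M. of_nat (card {a \<in> A. w a = M}))"

text \<open>
  For a linearly independent family \<open>u\<close> indexed by \<open>I\<close>, the (finite) expansion of \<open>g\<close> in
  terms of \<open>u\<close> is unique, so this says that \<open>g\<close> has an expansion and that its
  coefficients are nonnegative.
\<close>

definition positive_in :: "'i set \<Rightarrow> ('i \<Rightarrow> series) \<Rightarrow> series \<Rightarrow> bool" where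
  "positive_in I u g \<longleftrightarrow>
     (\<exists>J c. finite J \<and> J \<subseteq> I \<and> (\<forall>i\<in>J. 0 \<le> c i) \<and> g = (\<lambda>M. \<Sum>i\<in>J. c i * u i M))"


section \<open>Fundamental quasi-symmetric functions\<close>

text \<open>The sequence \<open>i\<^sub>1, \<dots>, i\<^sub>d\<close> is a list, whose \<open>j\<close>th entry is at position \<open>j - 1\<close>.\<close>

definition fundamental_Q :: "nat set \<Rightarrow> nat \<Rightarrow> series" where
  "fundamental_Q S d =
     monomial_sum {xs. length xs = d \<and> sorted xs \<and> (\<forall>j\<in>S. xs ! (j - 1) < xs ! j)} mset"

definition Q_positive :: "series \<Rightarrow> bool" where
  "Q_positive = positive_in {(S, d). S \<subseteq> {1..<d}} (\<lambda>(S, d). fundamental_Q S d)"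


section \<open>Integer partitions and monomial symmetric functions\<close>

text \<open>An integer partition is the multiset of its parts.\<close>

definition int_partitions :: "nat multiset set" where
  "int_partitions = {\<mu>. 0 \<notin># \<mu>}"

definition parts :: "nat multiset \<Rightarrow> nat list" where
  "parts \<mu> = rev (sorted_list_of_multiset \<mu>)"

definition exponents :: "nat multiset \<Rightarrow> nat multiset" where
  "exponents M = image_mset (count M) (mset_set (set_mset M))"

definition monomial_sf :: "nat multiset \<Rightarrow> series" where
  "monomial_sf \<mu> = monomial_sum {M. exponents M = \<mu>} (\<lambda>M. M)"

definition aug_monomial_sf :: "nat multiset \<Rightarrow> series" where
  "aug_monomial_sf \<mu> = (\<lambda>M. (\<Prod>i\<in>set_mset \<mu>. fact (count \<mu> i)) * monomial_sf \<mu> M)"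

definition block_sizes :: "'a set set \<Rightarrow> nat multiset" where
  "block_sizes P = image_mset card (mset_set P)"


section \<open>The functions \<open>\<Xi>\<close>\<close>

definition diagram :: "nat multiset \<Rightarrow> (nat \<times> nat) set" where
  "diagram \<mu> = {(i, j). i < size \<mu> \<and> j < parts \<mu> ! i}"

text \<open>The \<open>i\<close>th path of the digraph of \<open>\<mu>\<close> runs through the cells of the \<open>i\<close>th row of the diagram.\<close>

definition path_digraph :: "nat multiset \<Rightarrow> (nat \<times> nat) pair_pre_digraph" where
  "path_digraph \<mu> =
     \<lparr> pverts = diagram \<mu>,
       parcs = {((i, j), (i, Suc j)) |i j. (i, j) \<in> diagram \<mu> \<and> (i, Suc j) \<in> diagram \<mu>} \<rparr>"

text \<open>The vertex sets of the connected components of the spanning subgraph with edge set \<open>F\<close>.\<close>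

definition path_partition :: "nat multiset \<Rightarrow> (nat \<times> nat) rel \<Rightarrow> (nat \<times> nat) set set" where
  "path_partition \<mu> F = pverts (path_digraph \<mu>) // (F \<union> F\<inverse>)\<^sup>*"

definition tilde_Xi :: "nat multiset \<Rightarrow> series" where
  "tilde_Xi \<mu> = (\<lambda>M. \<Sum>F\<in>Pow (parcs (path_digraph \<mu>)).
     aug_monomial_sf (block_sizes (path_partition \<mu> F)) M / fact (card (path_partition \<mu> F)))"

definition Xi_positive :: "series \<Rightarrow> bool" where
  "Xi_positive = positive_in int_partitions tilde_Xi"


section \<open>Chromatic symmetric functions and Schur functions\<close>

text \<open>
  Graphs are instances of \<^locale>\<open>pair_graph\<close>: the arcs form a symmetric irreflexive relation
  on the finite vertex set, each undirected edge being represented by its two orientations.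
\<close>

definition stable_partition :: "'a pair_pre_digraph \<Rightarrow> 'a set set \<Rightarrow> bool" where
  "stable_partition G P \<longleftrightarrow>
     partition_on (pverts G) P \<and> (\<forall>B\<in>P. \<forall>u\<in>B. \<forall>v\<in>B. (u, v) \<notin> parcs G)"

definition chromatic_sf :: "'a pair_pre_digraph \<Rightarrow> series" where
  "chromatic_sf G = (\<lambda>M. \<Sum>P | stable_partition G P. aug_monomial_sf (block_sizes P) M)"

definition semistandard_tableaux :: "nat multiset \<Rightarrow> (nat \<times> nat \<Rightarrow> nat) set" where
  "semistandard_tableaux \<mu> =
     {T \<in> extensional (diagram \<mu>).
        (\<forall>i j. (i, j) \<in> diagram \<mu> \<and> (i, Suc j) \<in> diagram \<mu> \<longrightarrow> T (i, j) \<le> T (i, Suc j)) \<and>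
        (\<forall>i j. (i, j) \<in> diagram \<mu> \<and> (Suc i, j) \<in> diagram \<mu> \<longrightarrow> T (i, j) < T (Suc i, j))}"

definition schur :: "nat multiset \<Rightarrow> series" where
  "schur \<mu> = monomial_sum (semistandard_tableaux \<mu>) (\<lambda>T. image_mset T (mset_set (diagram \<mu>)))"

end

theory Submission
  imports Defs "HOL-Combinatorics.Multiset_Permutations"
begin

text \<open>
  Averaging the coefficients of a series over all rearrangements of the
  exponents projects the quasi-symmetric functions linearly onto the symmetric functions.  Under
  this projection the monomial quasi-symmetric function of a composition \<open>\<alpha>\<close> of length \<open>l\<close> with
  underlying partition \<open>\<mu>\<close> becomes \<open>m\<^sub>\<mu>\<close> divided by the number of rearrangements of \<open>\<mu>\<close>, which is the
  augmented monomial function of \<open>\<mu>\<close> divided by \<open>l!\<close>.  These are the summands of \<open>\<Xi>\<close>.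

  The function \<open>Q\<^sub>S\<close> is the sum of the monomial quasi-symmetric functions over the refinements of the
  composition \<open>\<alpha>(S)\<close> with partial sums \<open>S\<close>.  To refine \<open>\<alpha>(S)\<close> is to delete edges from disjoint paths
  with \<open>\<alpha>(S)\<^sub>1, \<alpha>(S)\<^sub>2, \<dots>\<close> vertices.  So the projection of \<open>Q\<^sub>S\<close> is exactly the \<open>\<Xi>\<close> of the
  partition underlying \<open>\<alpha>(S)\<close> (\<open>symmetrization_fundamental_Q\<close>).  Hence the
  projection of any \<open>Q\<close>-positive series is \<open>\<Xi>\<close>-positive, and a symmetric function is its own
  projection.

  For the two special families the \<open>Q\<close>-expansion comes from Stanley's theory of
  \<open>(P, \<omega>)\<close>-partitions: sorting the elements of \<open>P\<close> by colour, with ties broken by the labelling,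
  splits the generating function into one \<open>Q\<^sub>S\<close> for each linear extension of \<open>P\<close>
  (\<open>Q_positive_labelled_P_partitions\<close>).  Semistandard tableaux are \<open>(P, \<omega>)\<close>-partitions of the
  diagram.  Proper colourings are the disjoint union, over the orientations of the graph that they
  induce, of strict \<open>P\<close>-partitions.

  What remains is to see that both families are fixed by, or arise from, the projection.  The
  chromatic symmetric function is, by counting the ways to colour the blocks of a stable partition,
  the projection of the generating function of the proper colourings.  The Schur functions are
  symmetric by the Bender--Knuth involution, carried out here on the numbers of entries below a bound
  in each row.  These numbers form a Gelfand--Tsetlin pattern, where the involution is the
  reflection of one row of the pattern in the box cut out by its neighbours.
\<close>

section \<open>Averaging over packed monomials\<close>

text \<open>
  A packed monomial with exponents \<open>N\<close> represents one rearrangement of \<open>N\<close>: its variables form an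
  initial segment, so it is determined by the list of its exponents.
\<close>

definition packed_monomials :: "nat multiset \<Rightarrow> nat multiset set" where
  "packed_monomials N = {M. (\<exists>k. set_mset M = {..<k}) \<and> exponents M = N}"

definition symmetrization :: "series \<Rightarrow> series" where
  "symmetrization h = (\<lambda>M. (\<Sum>M'\<in>packed_monomials (exponents M). h M')
     / of_nat (card (packed_monomials (exponents M))))"

lemma size_exponents: "size (exponents M) = card (set_mset M)"
  by (simp add: exponents_def)

lemma zero_notin_exponents: "0 \<notin># exponents M"
  by (auto simp: exponents_def simp flip: not_in_iff)

lemma exponents_eq_mset_map:
  assumes "set_mset M = {..<k}"
  shows "exponents M = mset (map (count M) [0..<k])"
  using assms by (simp add: exponents_def lessThan_atLeast0)

lemma bij_betw_packed_monomials:
  assumes "0 \<notin># N"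
  shows "bij_betw (\<lambda>M. map (count M) [0..<size N]) (packed_monomials N) (permutations_of_multiset N)"
proof (rule bij_betwI')
  have set_packed: "set_mset M = {..<size N}" if M: "M \<in> packed_monomials N" for M
  proof -
    obtain k where "set_mset M = {..<k}" "exponents M = N"
      using M by (auto simp: packed_monomials_def)
    with size_exponents[of M] show ?thesis by simp
  qed
  show "map (count M) [0..<size N] = map (count M') [0..<size N] \<longleftrightarrow> M = M'"
    if "M \<in> packed_monomials N" "M' \<in> packed_monomials N" for M M'
  proof
    assume eq: "map (count M) [0..<size N] = map (count M') [0..<size N]"
    show "M = M'"
    proof (rule multiset_eqI)
      fix i
      show "count M i = count M' i"
      proof (cases "i < size N")
        case False
        then have "i \<notin># M" "i \<notin># M'"
          using set_packed[OF that(1)] set_packed[OF that(2)] by simp_all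
        then show ?thesis by (simp add: not_in_iff)
      next
        case True
        then show ?thesis using arg_cong[OF eq, of "\<lambda>xs. xs ! i"] by simp
      qed
    qed
  qed auto
  show "map (count M) [0..<size N] \<in> permutations_of_multiset N" if "M \<in> packed_monomials N" for M
  proof -
    have "exponents M = N" using that by (simp add: packed_monomials_def)
    with exponents_eq_mset_map[OF set_packed[OF that]] show ?thesis
      unfolding permutations_of_multiset_def mem_Collect_eq by metis
  qed
  show "\<exists>M\<in>packed_monomials N. \<alpha> = map (count M) [0..<size N]" if "\<alpha> \<in> permutations_of_multiset N" for \<alpha>
  proof
    have \<alpha>: "mset \<alpha> = N" "length \<alpha> = size N"
      using that by (auto simp: permutations_of_multiset_def)
    define M where "M = (\<Sum>i<size N. replicate_mset (\<alpha> ! i) i)"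
    have count: "count M i = (if i < size N then \<alpha> ! i else 0)" for i
      by (simp add: M_def count_sum)
    have pos: "\<alpha> ! i > 0" if "i < size N" for i
    proof -
      have "\<alpha> ! i \<in># N" using that \<alpha> nth_mem_mset[of i \<alpha>] by simp
      with assms show ?thesis by (auto intro: gr0I)
    qed
    have set: "set_mset M = {..<size N}"
      using pos by (auto simp: count split: if_splits simp flip: count_greater_zero_iff)
    show list: "\<alpha> = map (count M) [0..<size N]"
      by (rule nth_equalityI) (auto simp: \<alpha> count)
    show "M \<in> packed_monomials N"
      unfolding packed_monomials_def mem_Collect_eq
      using set exponents_eq_mset_map[OF set] list \<alpha>(1) by metis
  qed
qed

text \<open>
  The multinomial coefficient that turns the factor \<open>r\<^sub>1! r\<^sub>2! \<dots>\<close> of an augmented monomial function into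
  a factorial of the number of parts.
\<close>

lemma card_packed_monomials:
  assumes "0 \<notin># N"
  shows "card (packed_monomials N) * (\<Prod>i\<in>set_mset N. fact (count N i)) = fact (size N)"
  using bij_betw_same_card[OF bij_betw_packed_monomials[OF assms]]
  by (simp add: card_permutations_of_multiset_aux)

lemma card_packed_monomials_pos:
  assumes "0 \<notin># N"
  shows "card (packed_monomials N) > 0"
  using card_packed_monomials[OF assms] by (metis fact_nonzero gr0I mult_zero_left)

lemma finite_packed_monomials: "finite (packed_monomials (exponents M))"
  using card_packed_monomials_pos[OF zero_notin_exponents] card_ge_0_finite by blast

lemma aug_monomial_sf_eq:
  "aug_monomial_sf \<mu> M =
     (if exponents M = \<mu> then fact (size \<mu>) / of_nat (card (packed_monomials \<mu>)) else 0)"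
proof -
  have "{M' \<in> {M'. exponents M' = \<mu>}. M' = M} = (if exponents M = \<mu> then {M} else {})"
    by auto
  then have 1: "monomial_sf \<mu> M = (if exponents M = \<mu> then 1 else 0)"
    by (simp add: monomial_sf_def monomial_sum_def)
  show ?thesis
  proof (cases "exponents M = \<mu>")
    case True
    then have z: "0 \<notin># \<mu>" using zero_notin_exponents by blast
    from card_packed_monomials[OF this]
    have "of_nat (card (packed_monomials \<mu>)) * (\<Prod>i\<in>set_mset \<mu>. fact (count \<mu> i)) = (fact (size \<mu>) :: rat)"
      by (metis (mono_tags, lifting) of_nat_fact of_nat_mult of_nat_prod prod.cong)
    with card_packed_monomials_pos[OF z] 1 True show ?thesis
      by (simp add: aug_monomial_sf_def field_simps)
  qed (simp add: 1 aug_monomial_sf_def)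
qed

lemma symmetrization_cmult_sum:
  "symmetrization (\<lambda>M. \<Sum>i\<in>J. c i * u i M) = (\<lambda>M. \<Sum>i\<in>J. c i * symmetrization (u i) M)"
proof
  fix M
  let ?A = "packed_monomials (exponents M)"
  have "(\<Sum>M'\<in>?A. \<Sum>i\<in>J. c i * u i M') = (\<Sum>i\<in>J. c i * (\<Sum>M'\<in>?A. u i M'))"
    unfolding sum_distrib_left by (rule sum.swap)
  then show "symmetrization (\<lambda>M. \<Sum>i\<in>J. c i * u i M) M = (\<Sum>i\<in>J. c i * symmetrization (u i) M)"
    by (simp add: symmetrization_def sum_divide_distrib[where A = J])
qed

lemma symmetrization_eq_self:
  assumes "\<And>M M'. exponents M = exponents M' \<Longrightarrow> g M = g M'"
  shows "symmetrization g = g"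
proof
  fix M
  have "(\<Sum>M'\<in>packed_monomials (exponents M). g M')
      = (\<Sum>M'\<in>packed_monomials (exponents M). g M)"
    by (intro sum.cong refl assms) (auto simp: packed_monomials_def)
  then show "symmetrization g M = g M"
    using card_packed_monomials_pos[OF zero_notin_exponents[of M]] by (simp add: symmetrization_def)
qed

text \<open>
  Both monomials, padded by exponents 0 on a common finite set of variables, have the same multiset
  of exponents, so some permutation of that set matches the exponents.
\<close>

lemma ex_permutes_of_exponents_eq:
  assumes "exponents M = exponents M'"
  obtains p where "p permutes (set_mset M \<union> set_mset M')" "image_mset p M = M'"
proof -
  define A where "A = set_mset M \<union> set_mset M'"
  have fin: "finite A" by (simp add: A_def)
  have split: "image_mset (count K) (mset_set A) =
      exponents K + replicate_mset (card A - size (exponents K)) 0"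
    if "set_mset K \<subseteq> A" for K
  proof -
    have "A = set_mset K \<union> (A - set_mset K)" using that by auto
    then have "mset_set A = mset_set (set_mset K) + mset_set (A - set_mset K)"
      by (metis Diff_disjoint fin finite_Diff finite_set_mset mset_set_Union)
    moreover have "image_mset (count K) (mset_set (A - set_mset K)) = image_mset (\<lambda>_. 0) (mset_set (A - set_mset K))"
      using fin by (intro image_mset_cong) (auto simp: not_in_iff)
    moreover have "card (A - set_mset K) = card A - size (exponents K)"
      using that by (simp add: size_exponents card_Diff_subset)
    ultimately show ?thesis by (simp add: exponents_def image_mset_const_eq)
  qed
  have "image_mset (count M) (mset_set A) = image_mset (count M') (mset_set A)"
    using split[of M] split[of M'] assms by (simp add: A_def)
  from image_mset_eq_implies_permutes[OF fin this]
  obtain p where p: "p permutes A" "\<forall>x\<in>A. count M x = count M' (p x)" by blast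
  have "image_mset p M = M'"
  proof (rule multiset_eqI)
    fix y
    have "p -` {y} = {inv p y}"
      using p(1) by (auto simp: permutes_inv_eq permutes_inverses)
    then have 1: "count (image_mset p M) y = count M (inv p y)"
      by (auto simp: count_image_mset not_in_iff Int_insert_left)
    show "count (image_mset p M) y = count M' y"
    proof (cases "y \<in> A")
      case True
      then have "inv p y \<in> A" using p(1) by (simp add: permutes_in_image permutes_inv)
      with p 1 show ?thesis by (simp add: permutes_inverses)
    next
      case False
      then have "inv p y \<notin> A" using p(1) by (simp add: permutes_in_image permutes_inv)
      with False 1 show ?thesis by (auto simp: A_def not_in_iff)
    qed
  qed
  with p(1) that show thesis by (simp add: A_def)
qed

lemma symmetrization_symmetric_function:
  assumes "symmetric_function g"
  shows "symmetrization g = g"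
proof (rule symmetrization_eq_self)
  fix M M' :: "nat multiset"
  assume "exponents M = exponents M'"
  then obtain p where "p permutes (set_mset M \<union> set_mset M')" "image_mset p M = M'"
    by (rule ex_permutes_of_exponents_eq)
  with assms show "g M = g M'"
    unfolding symmetric_function_def by (metis permutes_bij)
qed

section \<open>Closure properties of positivity\<close>

lemma positive_in_single: "i \<in> I \<Longrightarrow> positive_in I u (u i)"
  unfolding positive_in_def by (rule exI[of _ "{i}"], rule exI[of _ "\<lambda>_. 1"]) auto

lemma positive_in_zero: "positive_in I u (\<lambda>_. 0)"
  unfolding positive_in_def by (rule exI[of _ "{}"]) auto

lemma positive_in_add:
  assumes "positive_in I u g" "positive_in I u h"
  shows "positive_in I u (\<lambda>M. g M + h M)"
proof -
  obtain J c where J: "finite J" "J \<subseteq> I" "\<forall>i\<in>J. 0 \<le> c i" "g = (\<lambda>M. \<Sum>i\<in>J. c i * u i M)"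
    using assms(1) by (auto simp: positive_in_def)
  obtain K b where K: "finite K" "K \<subseteq> I" "\<forall>i\<in>K. 0 \<le> b i" "h = (\<lambda>M. \<Sum>i\<in>K. b i * u i M)"
    using assms(2) by (auto simp: positive_in_def)
  define a where "a i = (if i \<in> J then c i else 0) + (if i \<in> K then b i else 0)" for i
  have "(\<Sum>i\<in>J. c i * u i M) = (\<Sum>i\<in>J \<union> K. (if i \<in> J then c i else 0) * u i M)" for M
    using J(1) K(1) by (intro sum.mono_neutral_cong_left) auto
  moreover have "(\<Sum>i\<in>K. b i * u i M) = (\<Sum>i\<in>J \<union> K. (if i \<in> K then b i else 0) * u i M)" for M
    using J(1) K(1) by (intro sum.mono_neutral_cong_left) auto
  ultimately have "(\<lambda>M. g M + h M) = (\<lambda>M. \<Sum>i\<in>J \<union> K. a i * u i M)"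
    by (simp add: J(4) K(4) a_def distrib_right sum.distrib)
  then show ?thesis
    unfolding positive_in_def using J K
    by (intro exI[of _ "J \<union> K"] exI[of _ a]) (auto simp: a_def)
qed

lemma positive_in_cmult:
  assumes "positive_in I u g" "0 \<le> a"
  shows "positive_in I u (\<lambda>M. a * g M)"
proof -
  obtain J c where J: "finite J" "J \<subseteq> I" "\<forall>i\<in>J. 0 \<le> c i" "g = (\<lambda>M. \<Sum>i\<in>J. c i * u i M)"
    using assms(1) by (auto simp: positive_in_def)
  then show ?thesis
    unfolding positive_in_def using assms(2)
    by (intro exI[of _ J] exI[of _ "\<lambda>i. a * c i"]) (auto simp: sum_distrib_left mult.assoc)
qed

lemma positive_in_sum:
  assumes "finite J" "\<And>j. j \<in> J \<Longrightarrow> positive_in I u (g j)"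
  shows "positive_in I u (\<lambda>M. \<Sum>j\<in>J. g j M)"
  using assms by induction (auto intro: positive_in_add positive_in_zero)

section \<open>Packed words and their ascents\<close>

definition strict_ascents :: "nat list \<Rightarrow> nat set" where
  "strict_ascents L = {j \<in> {1..<length L}. L ! (j - 1) < L ! j}"

text \<open>
  The packed weakly increasing word that has its strict ascents exactly at \<open>T\<close>.  Its letters name the
  parts of the composition of \<open>d\<close> with partial sums \<open>T\<close>.
\<close>

definition ascent_word :: "nat \<Rightarrow> nat set \<Rightarrow> nat list" where
  "ascent_word d T = map (\<lambda>j. card (T \<inter> {0<..j})) [0..<d]"

lemma strict_ascents_subset: "strict_ascents L \<subseteq> {1..<length L}"
  by (auto simp: strict_ascents_def)

lemma nth_eq_of_notin_strict_ascents:
  assumes "sorted L" "j \<in> {1..<length L}" "j \<notin> strict_ascents L"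
  shows "L ! (j - 1) = L ! j"
  using assms sorted_nth_mono[of L "j - 1" j] by (auto simp: strict_ascents_def)

text \<open>A monomial can only come from its own sorted list of indices, so each coefficient is 0 or 1.\<close>

lemma fundamental_Q_eq:
  assumes "S \<subseteq> {1..<d}"
  shows "fundamental_Q S d M =
    (if size M = d \<and> S \<subseteq> strict_ascents (sorted_list_of_multiset M) then 1 else 0)"
proof -
  have len: "length (sorted_list_of_multiset M) = size M"
    by (metis mset_sorted_list_of_multiset size_mset)
  have iff: "length xs = d \<and> sorted xs \<and> (\<forall>j\<in>S. xs ! (j - 1) < xs ! j) \<and> mset xs = M
      \<longleftrightarrow> xs = sorted_list_of_multiset M \<and> size M = d \<and> S \<subseteq> strict_ascents xs" for xs
    using assms by (auto simp: strict_ascents_def len sorted_sort_id subset_iff)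
  have "{xs \<in> {xs. length xs = d \<and> sorted xs \<and> (\<forall>j\<in>S. xs ! (j - 1) < xs ! j)}. mset xs = M}
      = (if size M = d \<and> S \<subseteq> strict_ascents (sorted_list_of_multiset M)
         then {sorted_list_of_multiset M} else {})"
    using iff by (auto split: if_splits)
  then show ?thesis by (simp add: fundamental_Q_def monomial_sum_def)
qed

lemma card_Int_greaterThanAtMost_Suc:
  "card (T \<inter> {0<..Suc j}) = card (T \<inter> {0<..j}) + (if Suc j \<in> T then 1 else 0)"
proof -
  have "T \<inter> {0<..Suc j} = (if Suc j \<in> T then insert (Suc j) (T \<inter> {0<..j}) else T \<inter> {0<..j})"
    by (auto simp: le_Suc_eq)
  then show ?thesis by simp
qed

lemma sorted_ascent_word: "sorted (ascent_word d T)"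
  unfolding ascent_word_def sorted_map
  by (rule sorted_wrt_mono_rel[OF _ sorted_upt]) (auto intro!: card_mono)

lemma strict_ascents_ascent_word:
  assumes "T \<subseteq> {1..<d}"
  shows "strict_ascents (ascent_word d T) = T"
proof -
  have "ascent_word d T ! (j - 1) < ascent_word d T ! j \<longleftrightarrow> j \<in> T" if j: "j \<in> {1..<d}" for j
  proof -
    obtain i where "j = Suc i" using j by (cases j) auto
    with j card_Int_greaterThanAtMost_Suc[of T i] show ?thesis by (simp add: ascent_word_def)
  qed
  moreover have "length (ascent_word d T) = d" by (simp add: ascent_word_def)
  ultimately show ?thesis using assms by (auto simp: strict_ascents_def)
qed

lemma set_ascent_word: "\<exists>k. set (ascent_word d T) = {..<k}"
proof (cases d)
  case (Suc n)
  have "(\<lambda>j. card (T \<inter> {0<..j})) ` {..n} = {..card (T \<inter> {0<..n})}"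
  proof (induction n)
    case (Suc n)
    then show ?case
      by (auto simp: card_Int_greaterThanAtMost_Suc[of T n] atMost_Suc)
  qed auto
  moreover have "set (ascent_word d T) = (\<lambda>j. card (T \<inter> {0<..j})) ` {..n}"
    by (simp add: ascent_word_def Suc atLeastLessThanSuc_atLeastAtMost atMost_atLeast0 del: upt_Suc)
  ultimately have "set (ascent_word d T) = {..<Suc (card (T \<inter> {0<..n}))}"
    by (simp only: lessThan_Suc_atMost)
  then show ?thesis by blast
qed (auto simp: ascent_word_def intro: exI[of _ 0])

text \<open>
  In a packed sorted word the letter grows by exactly 1 at each strict ascent, since a larger jump
  would leave a letter out.
\<close>

lemma ascent_word_strict_ascents:
  assumes "sorted L" "set L = {..<k}"
  shows "ascent_word (length L) (strict_ascents L) = L"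
proof (rule nth_equalityI)
  fix j assume "j < length (ascent_word (length L) (strict_ascents L))"
  then have "j < length L" by (simp add: ascent_word_def)
  then have "card (strict_ascents L \<inter> {0<..j}) = L ! j"
  proof (induction j)
    case 0
    then have "0 \<in> set L" using assms(2) by (metis length_pos_if_in_set lessThan_iff nth_mem not_gr_zero not_less0)
    then obtain i where "i < length L" "L ! i = 0" by (auto simp: in_set_conv_nth)
    then have "L ! 0 = 0" using sorted_nth_mono[OF assms(1), of 0 i] by simp
    then show ?case by simp
  next
    case (Suc j)
    have "L ! Suc j \<le> Suc (L ! j)"
    proof (rule ccontr)
      assume gap: "\<not> L ! Suc j \<le> Suc (L ! j)"
      have "L ! Suc j \<in> set L" using Suc.prems by simp
      then have "Suc (L ! j) \<in> set L" using assms(2) gap by auto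
      then obtain i where i: "i < length L" "L ! i = Suc (L ! j)" by (auto simp: in_set_conv_nth)
      show False
      proof (cases "i \<le> j")
        case True
        then show ?thesis using sorted_nth_mono[OF assms(1), of i j] i Suc.prems by simp
      next
        case False
        then show ?thesis using sorted_nth_mono[OF assms(1), of "Suc j" i] i gap by simp
      qed
    qed
    moreover have "L ! j \<le> L ! Suc j" using sorted_nth_mono[OF assms(1), of j "Suc j"] Suc.prems by simp
    moreover have "Suc j \<in> strict_ascents L \<longleftrightarrow> L ! j < L ! Suc j"
      using Suc.prems by (simp add: strict_ascents_def)
    ultimately show ?case using Suc by (auto simp: card_Int_greaterThanAtMost_Suc[of _ j])
  qed
  then show "ascent_word (length L) (strict_ascents L) ! j = L ! j"
    using \<open>j < length L\<close> by (simp add: ascent_word_def)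
qed (simp add: ascent_word_def)

text \<open>
  This is the correspondence between the compositions of \<open>d\<close>, as packed monomials of degree \<open>d\<close>, and
  the sets of their partial sums.
\<close>

lemma bij_betw_strict_ascents:
  "bij_betw (\<lambda>M. strict_ascents (sorted_list_of_multiset M))
     {M. (\<exists>k. set_mset M = {..<k}) \<and> size M = d} (Pow {1..<d})"
proof (rule bij_betw_byWitness[where f' = "\<lambda>T. mset (ascent_word d T)"])
  have len: "length (sorted_list_of_multiset M) = size M" for M :: "nat multiset"
    by (metis mset_sorted_list_of_multiset size_mset)
  show "\<forall>M\<in>{M. (\<exists>k. set_mset M = {..<k}) \<and> size M = d}.
      mset (ascent_word d (strict_ascents (sorted_list_of_multiset M))) = M"
  proof safe
    fix M :: "nat multiset" and k assume "set_mset M = {..<k}" "d = size M"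
    then show "mset (ascent_word (size M) (strict_ascents (sorted_list_of_multiset M))) = M"
      using ascent_word_strict_ascents[of "sorted_list_of_multiset M" k] by (simp add: len)
  qed
  show "\<forall>T\<in>Pow {1..<d}. strict_ascents (sorted_list_of_multiset (mset (ascent_word d T))) = T"
    by (simp add: sorted_sort_id sorted_ascent_word strict_ascents_ascent_word)
  show "(\<lambda>M. strict_ascents (sorted_list_of_multiset M)) `
      {M. (\<exists>k. set_mset M = {..<k}) \<and> size M = d} \<subseteq> Pow {1..<d}"
    using strict_ascents_subset len by fastforce
  show "(\<lambda>T. mset (ascent_word d T)) ` Pow {1..<d} \<subseteq> {M. (\<exists>k. set_mset M = {..<k}) \<and> size M = d}"
    using set_ascent_word by (auto simp: ascent_word_def)
qed

lemma mem_downset_iff: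
  assumes "finite A" "\<And>i j. j \<in> A \<Longrightarrow> i < j \<Longrightarrow> i \<in> A"
  shows "(i :: nat) \<in> A \<longleftrightarrow> i < card A"
proof -
  have "A = {..<card A}"
  proof (cases "A = {}")
    case False
    have "A \<subseteq> {..Max A}" using Max_ge[OF assms(1)] by blast
    moreover have "{..Max A} \<subseteq> A"
      using assms(2)[OF Max_in[OF assms(1) False]] Max_in[OF assms(1) False]
      by (auto simp: le_eq_less_or_eq)
    ultimately have "A = {..Max A}" by blast
    then show ?thesis by (metis card_lessThan lessThan_Suc_atMost)
  qed simp
  then show ?thesis by blast
qed

text \<open>Each letter of a sorted word occupies an interval of positions.\<close>

lemma sorted_nth_eq_iff:
  fixes L :: "nat list"
  assumes "sorted L" "j < length L"
  defines "s \<equiv> \<lambda>x. card {i. i < length L \<and> L ! i < x}"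
  shows "L ! j = x \<longleftrightarrow> s x \<le> j \<and> j < s x + count (mset L) x"
    and "s x + count (mset L) x \<le> length L"
proof -
  have less: "L ! j < y \<longleftrightarrow> j < s y" for y
  proof -
    have "j \<in> {i. i < length L \<and> L ! i < y} \<longleftrightarrow> j < card {i. i < length L \<and> L ! i < y}"
      by (rule mem_downset_iff) (use sorted_nth_mono[OF assms(1)] in \<open>auto intro: le_less_trans order.strict_implies_order\<close>)
    then show ?thesis using assms(2) by (simp add: s_def)
  qed
  have "{i. i < length L \<and> L ! i < Suc x} = {i. i < length L \<and> L ! i < x} \<union> {i. i < length L \<and> L ! i = x}"
    by auto
  then have "s (Suc x) = s x + card {i. i < length L \<and> L ! i = x}"
    unfolding s_def by (simp only:) (rule card_Un_disjoint, auto)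
  moreover have "count (mset L) x = card {i. i < length L \<and> L ! i = x}"
    by (simp add: count_mset count_list_eq_length_filter length_filter_conv_card eq_commute)
  ultimately have suc: "s (Suc x) = s x + count (mset L) x" by simp
  show "L ! j = x \<longleftrightarrow> s x \<le> j \<and> j < s x + count (mset L) x"
    using less[of x] less[of "Suc x"] suc by auto
  have "s (Suc x) \<le> card {..<length L}" unfolding s_def by (rule card_mono) auto
  with suc show "s x + count (mset L) x \<le> length L" by simp
qed

section \<open>Level sets of colourings\<close>

definition colour_monomial :: "'a set \<Rightarrow> ('a \<Rightarrow> nat) \<Rightarrow> nat multiset" where
  "colour_monomial V \<kappa> = image_mset \<kappa> (mset_set V)"

definition level_sets :: "('a \<Rightarrow> 'b) \<Rightarrow> 'a set \<Rightarrow> 'a set set" where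
  "level_sets f V = (\<lambda>v. {u \<in> V. f u = f v}) ` V"

text \<open>
  The number of variables with a given exponent is the number of colours used that often, so the
  exponents of the monomial of a colouring are the sizes of its colour classes.
\<close>

lemma block_sizes_level_sets:
  assumes "finite V"
  shows "block_sizes (level_sets f V) = exponents (image_mset f (mset_set V))"
proof -
  have img: "level_sets f V = (\<lambda>x. {u \<in> V. f u = x}) ` f ` V" by (auto simp: level_sets_def)
  have inj: "inj_on (\<lambda>x. {u \<in> V. f u = x}) (f ` V)" by (auto simp: inj_on_def)
  have "count (image_mset f (mset_set V)) = (\<lambda>x. card {u \<in> V. f u = x})"
    using assms by (simp add: fun_eq_iff count_image_mset vimage_def Int_def conj_commute)
  then show ?thesis
    using assms by (simp add: block_sizes_def exponents_def img image_mset.compositionality comp_def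
        flip: image_mset_mset_set[OF inj])
qed

section \<open>The averaged fundamental functions\<close>

lemma finite_diagram: "finite (diagram \<mu>)"
proof -
  have "diagram \<mu> = (SIGMA i:{..<size \<mu>}. {..<parts \<mu> ! i})" by (auto simp: diagram_def)
  then show ?thesis by simp
qed

lemma finite_path_arcs: "finite (parcs (path_digraph \<mu>))"
  by (rule finite_subset[of _ "diagram \<mu> \<times> diagram \<mu>"]) (auto simp: path_digraph_def finite_diagram)

lemma mset_parts: "mset (parts \<mu>) = \<mu>"
  by (simp add: parts_def)

lemma length_parts: "length (parts \<mu>) = size \<mu>"
  by (metis mset_parts size_mset)

text \<open>
  The maximal constant runs of \<open>L\<close>, taken as paths on the positions, form a copy of the digraph of \<open>\<mu>\<close>.
  The runs come in the order of the composition and the rows of the diagram in decreasing order, so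
  the copy uses a permutation \<open>p\<close> matching runs with rows of equal length: position \<open>j\<close> goes to row
  \<open>p (L ! j)\<close>, at its distance from the start \<open>s\<close> of its run.
\<close>

lemma path_digraph_of_word:
  assumes "sorted L" "set L = {..<k}" "\<mu> = exponents (mset L)"
  obtains \<phi> where "bij_betw \<phi> {..<length L} (diagram \<mu>)"
    and "parcs (path_digraph \<mu>) = (\<lambda>j. (\<phi> (j - 1), \<phi> j)) ` ({1..<length L} - strict_ascents L)"
proof -
  define s where "s x = card {i. i < length L \<and> L ! i < x}" for x
  let ?c = "count (mset L)"
  have block: "L ! j = x \<longleftrightarrow> s x \<le> j \<and> j < s x + ?c x" if "j < length L" for j x
    using sorted_nth_eq_iff(1)[OF assms(1) that] by (simp add: s_def)
  have lt_k: "L ! j < k" if "j < length L" for j using that assms(2) nth_mem by blast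
  have "mset (map ?c [0..<k]) = mset (parts \<mu>)"
    using exponents_eq_mset_map[of "mset L" k] assms by (simp add: mset_parts)
  then obtain p where p': "p permutes {..<length (parts \<mu>)}" "permute_list p (parts \<mu>) = map ?c [0..<k]"
    by (rule mset_eq_permutation)
  note len = length_parts[of \<mu>]
  have k: "size \<mu> = k" using assms by (simp add: size_exponents)
  have p: "p permutes {..<k}" using p'(1) len k by simp
  have row: "parts \<mu> ! p x = ?c x" if "x < k" for x
    using permute_list_nth[OF p'(1), of x] p'(2) that len k by simp
  have p_less: "p x < k \<longleftrightarrow> x < k" for x using permutes_in_image[OF p, of x] by simp
  have p_eq: "p x = p y \<longleftrightarrow> x = y" for x y using permutes_inj[OF p] by (auto dest: injD)
  define \<phi> where "\<phi> j = (p (L ! j), j - s (L ! j))" for j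
  have in_diagram: "\<phi> j \<in> diagram \<mu>" if "j < length L" for j
    using that block[OF that, of "L ! j"] lt_k[OF that] by (auto simp: \<phi>_def diagram_def k p_less row)
  have onto: "\<exists>j<length L. s x \<le> j \<and> L ! j = x \<and> \<phi> j = (i, t)" if it: "(i, t) \<in> diagram \<mu>" "i = p x" for i t x
  proof -
    have x: "x < k" "t < ?c x" using it p_less row by (auto simp: diagram_def k)
    then have "x \<in> set L" using assms(2) by simp
    then obtain j where "j < length L" by (auto simp: in_set_conv_nth)
    from sorted_nth_eq_iff(2)[OF assms(1) this, of x] have "s x + t < length L"
      using x by (simp add: s_def)
    moreover from block[OF this, of x] x(2) have "L ! (s x + t) = x" by simp
    ultimately show ?thesis using it(2) by (auto simp: \<phi>_def intro!: exI[of _ "s x + t"])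
  qed
  have inj: "i = j" if "i < length L" "j < length L" "\<phi> i = \<phi> j" for i j
  proof -
    have "L ! i = L ! j" using that(3) by (simp add: \<phi>_def p_eq)
    with that block[of i "L ! j"] block[of j "L ! j"] show ?thesis by (auto simp: \<phi>_def)
  qed
  have "diagram \<mu> \<subseteq> \<phi> ` {..<length L}"
  proof
    fix v assume "v \<in> diagram \<mu>"
    moreover obtain i t where "v = (i, t)" by fastforce
    moreover have "i = p (inv p i)" using p by (simp add: permutes_inverses)
    ultimately show "v \<in> \<phi> ` {..<length L}" using onto[of i t "inv p i"] by force
  qed
  then have bij: "bij_betw \<phi> {..<length L} (diagram \<mu>)"
    using inj in_diagram by (auto simp: bij_betw_def inj_on_def)
  have "parcs (path_digraph \<mu>) = (\<lambda>j. (\<phi> (j - 1), \<phi> j)) ` ({1..<length L} - strict_ascents L)"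
  proof (intro equalityI subsetI)
    fix a assume "a \<in> parcs (path_digraph \<mu>)"
    then obtain i t where a: "a = ((i, t), (i, Suc t))" "(i, t) \<in> diagram \<mu>" "(i, Suc t) \<in> diagram \<mu>"
      by (auto simp: path_digraph_def)
    define x where "x = inv p i"
    have x: "i = p x" using p by (simp add: x_def permutes_inverses)
    obtain j where j: "j < length L" "s x \<le> j" "L ! j = x" "\<phi> j = (i, t)" using onto[OF a(2) x] by blast
    obtain j' where j': "j' < length L" "s x \<le> j'" "L ! j' = x" "\<phi> j' = (i, Suc t)" using onto[OF a(3) x] by blast
    have "j' = Suc j" using j j' by (auto simp: \<phi>_def)
    then show "a \<in> (\<lambda>j. (\<phi> (j - 1), \<phi> j)) ` ({1..<length L} - strict_ascents L)"
      using a(1) j j' by (intro image_eqI[of _ _ j']) (auto simp: strict_ascents_def)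
  next
    fix a assume "a \<in> (\<lambda>j. (\<phi> (j - 1), \<phi> j)) ` ({1..<length L} - strict_ascents L)"
    then obtain j where j: "a = (\<phi> (j - 1), \<phi> j)" "j \<in> {1..<length L}" "j \<notin> strict_ascents L" by auto
    have eq: "L ! (j - 1) = L ! j" using nth_eq_of_notin_strict_ascents[OF assms(1) j(2,3)] .
    then have "s (L ! j) \<le> j - 1" using block[of "j - 1" "L ! j"] j(2) by auto
    then have "\<phi> j = (p (L ! j), Suc (j - 1 - s (L ! j)))" using j(2) by (auto simp: \<phi>_def)
    moreover have "\<phi> (j - 1) = (p (L ! j), j - 1 - s (L ! j))" using eq by (simp add: \<phi>_def)
    moreover have "j < length L" "j - 1 < length L" using j(2) by auto
    ultimately show "a \<in> parcs (path_digraph \<mu>)"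
      using j(1) in_diagram[of j] in_diagram[of "j - 1"] by (simp add: path_digraph_def)
  qed
  with bij that show thesis by blast
qed

text \<open>
  Deleting from the path on all positions the edges at the strict ascents of \<open>L\<close> leaves as components
  the runs of equal letters.
\<close>

lemma quotient_path_eq_level_sets:
  assumes \<phi>: "bij_betw \<phi> {..<length L} V" and "sorted L"
  defines "F \<equiv> (\<lambda>j. (\<phi> (j - 1), \<phi> j)) ` ({1..<length L} - strict_ascents L)"
  defines "f \<equiv> \<lambda>v. L ! (the_inv_into {..<length L} \<phi> v)"
  shows "V // (F \<union> F\<inverse>)\<^sup>* = level_sets f V"
proof -
  let ?R = "(F \<union> F\<inverse>)\<^sup>*"
  have f: "f (\<phi> j) = L ! j" if "j < length L" for j
    using that \<phi> by (simp add: f_def bij_betw_def the_inv_into_f_f)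
  have V: "V = \<phi> ` {..<length L}" using \<phi> by (simp add: bij_betw_def)
  have step: "f u = f v \<and> u \<in> V \<and> v \<in> V" if "(u, v) \<in> F" for u v
  proof -
    obtain j where "u = \<phi> (j - 1)" "v = \<phi> j" "j \<in> {1..<length L}" "j \<notin> strict_ascents L"
      using \<open>(u, v) \<in> F\<close> by (auto simp: F_def)
    then show ?thesis
      using nth_eq_of_notin_strict_ascents[OF assms(2)] by (auto simp: f V)
  qed
  have level: "f u = f v \<and> v \<in> V" if "(u, v) \<in> ?R" "u \<in> V" for u v
    using that by induction (use step in force)+
  have forward: "(\<phi> i, \<phi> j) \<in> ?R" if "i \<le> j" "j < length L" "L ! i = L ! j" for i j
    using that
  proof (induction j rule: dec_induct)
    case (step n)
    have "L ! i \<le> L ! n" "L ! n \<le> L ! Suc n"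
      using sorted_nth_mono[OF assms(2), of i n] sorted_nth_mono[OF assms(2), of n "Suc n"] step.hyps step.prems by auto
    then have "L ! i = L ! n" "L ! n = L ! Suc n" using step.prems by auto
    then have "(\<phi> i, \<phi> n) \<in> ?R" "Suc n \<notin> strict_ascents L"
      using step by (auto simp: strict_ascents_def)
    moreover from this(2) have "(\<phi> n, \<phi> (Suc n)) \<in> F"
      using step.prems unfolding F_def by (intro image_eqI[of _ _ "Suc n"]) auto
    ultimately show ?case by (meson UnI1 rtrancl.rtrancl_into_rtrancl)
  qed auto
  have sym: "sym ?R" by (intro sym_rtrancl sym_Un_converse)
  have "?R `` {u} = {v \<in> V. f v = f u}" if u: "u \<in> V" for u
  proof (intro equalityI subsetI)
    fix v assume "v \<in> ?R `` {u}"
    then show "v \<in> {v \<in> V. f v = f u}" using level[of u v] u by simp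
  next
    fix v assume "v \<in> {v \<in> V. f v = f u}"
    then obtain j where j: "j < length L" "v = \<phi> j" "f v = f u" by (auto simp: V)
    moreover obtain i where i: "i < length L" "u = \<phi> i" using u by (auto simp: V)
    ultimately have "L ! j = L ! i" by (simp add: f)
    then have "(u, v) \<in> ?R"
      using i j forward[of i j] forward[of j i] symD[OF sym] by (cases "i \<le> j") auto
    then show "v \<in> ?R `` {u}" by simp
  qed
  then show ?thesis by (auto simp: quotient_def level_sets_def)
qed

lemma size_block_sizes: "size (block_sizes P) = card P"
  by (simp add: block_sizes_def)

text \<open>
  In each summand the augmented monomial function contributes the factorial of the number of blocks,
  which cancels against the denominator; what is left is the same for all \<open>F\<close> that contribute.
\<close>

lemma tilde_Xi_eq:
  "tilde_Xi \<mu> M =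
     of_nat (card {F \<in> Pow (parcs (path_digraph \<mu>)). block_sizes (path_partition \<mu> F) = exponents M})
       / of_nat (card (packed_monomials (exponents M)))"
proof -
  have "aug_monomial_sf (block_sizes (path_partition \<mu> F)) M / fact (card (path_partition \<mu> F))
    = (if block_sizes (path_partition \<mu> F) = exponents M then 1 / of_nat (card (packed_monomials (exponents M))) else 0)"
    for F
    by (auto simp: aug_monomial_sf_eq simp flip: size_block_sizes)
  then show ?thesis
    using finite_path_arcs by (simp add: tilde_Xi_def flip: sum.inter_filter)
qed

text \<open>
  After clearing the common denominator both sides count: on the left packed monomials, which
  correspond to sets \<open>T\<close> of strict ascents with \<open>S \<subseteq> T\<close>, and on the right sets of edges \<open>F\<close> of a union
  of paths.  The edges of that union are the steps outside \<open>S\<close>, and the edges kept are the steps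
  outside \<open>T\<close>; the exponents of the monomial are then the sizes of the components.
\<close>

theorem symmetrization_fundamental_Q:
  assumes S: "S \<subseteq> {1..<d}"
  shows "symmetrization (fundamental_Q S d) = tilde_Xi (exponents (mset (ascent_word d S)))"
proof
  fix M
  define L where "L = ascent_word d S"
  define \<mu> where "\<mu> = exponents (mset L)"
  have len: "length L = d" by (simp add: L_def ascent_word_def)
  obtain k where k: "set L = {..<k}" using set_ascent_word L_def by blast
  have asc: "strict_ascents L = S" using S by (simp add: L_def strict_ascents_ascent_word)
  obtain \<phi> where \<phi>: "bij_betw \<phi> {..<d} (diagram \<mu>)"
      "parcs (path_digraph \<mu>) = (\<lambda>j. (\<phi> (j - 1), \<phi> j)) ` ({1..<d} - S)"
    using path_digraph_of_word[OF _ k \<mu>_def] unfolding len asc by (metis L_def sorted_ascent_word)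
  define arc where "arc j = (\<phi> (j - 1), \<phi> j)" for j
  have inj: "inj_on arc {1..<d}"
    using \<phi>(1) by (auto simp: arc_def inj_on_def bij_betw_def)
  let ?asc = "\<lambda>M. strict_ascents (sorted_list_of_multiset M)"
  let ?F = "\<lambda>T. arc ` ({1..<d} - T)"
  have arc_mem: "arc j \<in> ?F T \<longleftrightarrow> j \<notin> T" if "j \<in> {1..<d}" for j T
    using inj_on_image_mem_iff[OF inj that, of "{1..<d} - T"] that by simp
  define X where "X = {M \<in> {M. (\<exists>k. set_mset M = {..<k}) \<and> size M = d}. S \<subseteq> ?asc M}"
  have "bij_betw ?asc X {T \<in> Pow {1..<d}. S \<subseteq> T}"
    unfolding X_def by (rule bij_betw_Collect[OF bij_betw_strict_ascents]) simp
  moreover have "bij_betw ?F {T \<in> Pow {1..<d}. S \<subseteq> T} (Pow (?F S))"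
  proof (rule bij_betw_byWitness[where f' = "\<lambda>F. {j \<in> {1..<d}. arc j \<notin> F}"])
    show "\<forall>T\<in>{T \<in> Pow {1..<d}. S \<subseteq> T}. {j \<in> {1..<d}. arc j \<notin> ?F T} = T"
    proof
      fix T assume "T \<in> {T \<in> Pow {1..<d}. S \<subseteq> T}"
      then show "{j \<in> {1..<d}. arc j \<notin> ?F T} = T" using arc_mem by blast
    qed
    show "\<forall>F\<in>Pow (?F S). ?F {j \<in> {1..<d}. arc j \<notin> F} = F"
      by auto
    show "(\<lambda>F. {j \<in> {1..<d}. arc j \<notin> F}) ` Pow (?F S) \<subseteq> {T \<in> Pow {1..<d}. S \<subseteq> T}"
    proof safe
      fix F j assume "F \<subseteq> ?F S" "j \<in> S"
      then show "j \<in> {1..<d}" using S by blast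
    next
      fix F j assume F: "F \<subseteq> ?F S" "j \<in> S" "arc j \<in> F"
      then have "arc j \<in> ?F S" by blast
      then show False using F(2) S arc_mem[of j S] by blast
    qed
  qed auto
  ultimately have bij: "bij_betw (?F \<circ> ?asc) X (Pow (parcs (path_digraph \<mu>)))"
    unfolding \<phi>(2) arc_def[symmetric] by (rule bij_betw_trans)
  \<comment> \<open>Colour each vertex by the letter at its position: the classes are the components, and the
    monomial of this colouring is \<open>M'\<close>.\<close>
  have blocks: "block_sizes (path_partition \<mu> ((?F \<circ> ?asc) M')) = exponents M'" if "M' \<in> X" for M'
  proof -
    let ?L = "sorted_list_of_multiset M'"
    have len': "length ?L = d" using that by (simp add: X_def flip: size_mset)
    let ?f = "\<lambda>v. ?L ! (the_inv_into {..<d} \<phi> v)"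
    have "path_partition \<mu> ((?F \<circ> ?asc) M') = level_sets ?f (diagram \<mu>)"
      using quotient_path_eq_level_sets[of \<phi> ?L "diagram \<mu>"] \<phi>(1)
      by (simp add: path_partition_def path_digraph_def len' arc_def)
    moreover have "image_mset ?f (mset_set (diagram \<mu>)) = M'"
    proof -
      have "mset_set (diagram \<mu>) = image_mset \<phi> (mset_set {..<d})"
        using \<phi>(1) by (simp add: image_mset_mset_set bij_betw_def)
      then have "image_mset ?f (mset_set (diagram \<mu>)) = image_mset (\<lambda>j. ?f (\<phi> j)) (mset_set {..<d})"
        by (simp add: image_mset.compositionality comp_def)
      also have "\<dots> = image_mset (\<lambda>j. ?L ! j) (mset_set {..<d})"
        using \<phi>(1) by (intro image_mset_cong) (simp add: bij_betw_def the_inv_into_f_f)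
      also have "\<dots> = mset (map (\<lambda>j. ?L ! j) [0..<d])" by (simp add: lessThan_atLeast0)
      also have "\<dots> = M'" by (simp only: len'[symmetric] map_nth mset_sorted_list_of_multiset)
      finally show ?thesis .
    qed
    ultimately show ?thesis by (simp add: block_sizes_level_sets finite_diagram)
  qed
  have "bij_betw (?F \<circ> ?asc) {M' \<in> X. exponents M' = exponents M}
      {F \<in> Pow (parcs (path_digraph \<mu>)). block_sizes (path_partition \<mu> F) = exponents M}"
    by (rule bij_betw_Collect[OF bij]) (simp only: blocks)
  from bij_betw_same_card[OF this]
  have card: "card {F \<in> Pow (parcs (path_digraph \<mu>)). block_sizes (path_partition \<mu> F) = exponents M}
      = card {M' \<in> X. exponents M' = exponents M}" by simp
  have "(\<Sum>M'\<in>packed_monomials (exponents M). fundamental_Q S d M')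
      = of_nat (card {M' \<in> packed_monomials (exponents M). size M' = d \<and> S \<subseteq> ?asc M'})"
    using finite_packed_monomials[of M]
    by (simp add: fundamental_Q_eq[OF S] flip: sum.inter_filter)
  also have "{M' \<in> packed_monomials (exponents M). size M' = d \<and> S \<subseteq> ?asc M'}
      = {M' \<in> X. exponents M' = exponents M}"
    by (auto simp: X_def packed_monomials_def)
  finally show "symmetrization (fundamental_Q S d) M = tilde_Xi (exponents (mset (ascent_word d S))) M"
    unfolding L_def[symmetric] \<mu>_def[symmetric] tilde_Xi_eq card symmetrization_def by simp
qed

lemma Xi_positive_symmetrization_Q:
  assumes "S \<subseteq> {1..<d}"
  shows "Xi_positive (symmetrization (fundamental_Q S d))"
  unfolding symmetrization_fundamental_Q[OF assms] Xi_positive_def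
  by (rule positive_in_single) (simp add: int_partitions_def zero_notin_exponents)

theorem Xi_positive_symmetrization:
  assumes "Q_positive g"
  shows "Xi_positive (symmetrization g)"
proof -
  obtain J c where J: "finite J" "J \<subseteq> {(S, d). S \<subseteq> {1..<d}}" "\<forall>i\<in>J. 0 \<le> c i"
      and g: "g = (\<lambda>M. \<Sum>i\<in>J. c i * (case i of (S, d) \<Rightarrow> fundamental_Q S d) M)"
    using assms by (auto simp: Q_positive_def positive_in_def)
  have "positive_in int_partitions tilde_Xi
      (\<lambda>M. \<Sum>i\<in>J. c i * symmetrization (case i of (S, d) \<Rightarrow> fundamental_Q S d) M)"
  proof (intro positive_in_sum positive_in_cmult)
    fix i assume "i \<in> J"
    then show "0 \<le> c i" using J by blast
    obtain S d where "i = (S, d)" by fastforce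
    then show "positive_in int_partitions tilde_Xi (symmetrization (case i of (S, d) \<Rightarrow> fundamental_Q S d))"
      using \<open>i \<in> J\<close> J Xi_positive_symmetrization_Q by (auto simp: Xi_positive_def)
  qed (use J in auto)
  then show ?thesis unfolding Xi_positive_def g
    by (subst symmetrization_cmult_sum)
qed

section \<open>The expansion of P-partition generating functions\<close>

text \<open>
  Only the finitely many colours occurring in \<open>M\<close> can be used.  This makes the coefficients additive
  when a set of colourings is split into classes.
\<close>

lemma finite_colourings:
  assumes "finite V"
  shows "finite {\<kappa> \<in> extensional V. colour_monomial V \<kappa> = M}"
proof (rule finite_subset)
  show "{\<kappa> \<in> extensional V. colour_monomial V \<kappa> = M} \<subseteq> V \<rightarrow>\<^sub>E set_mset M"
    using assms by (auto simp: colour_monomial_def PiE_def)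
qed (use assms in \<open>auto intro: finite_PiE\<close>)

lemma monomial_sum_fibres:
  assumes "finite R" "f ` A \<subseteq> R" "finite {a \<in> A. w a = M}"
  shows "monomial_sum A w M = (\<Sum>r\<in>R. monomial_sum {a \<in> A. f a = r} w M)"
proof -
  have "{a \<in> A. w a = M} = (\<Union>r\<in>R. {a \<in> {a \<in> A. f a = r}. w a = M})" using assms(2) by auto
  also have "card \<dots> = (\<Sum>r\<in>R. card {a \<in> {a \<in> A. f a = r}. w a = M})"
    by (rule card_UN_disjoint) (use assms in \<open>auto intro: finite_subset[OF _ assms(3)]\<close>)
  finally show ?thesis by (simp add: monomial_sum_def)
qed

text \<open>
  It suffices that \<open>P\<close> generates the intended partial order, and \<open>\<omega>\<close> is the labelling: along a pair
  in \<open>P\<close> the colour may stay constant only if the label increases.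
\<close>

definition labelled_P_partitions :: "'a set \<Rightarrow> 'a rel \<Rightarrow> ('a \<Rightarrow> nat) \<Rightarrow> ('a \<Rightarrow> nat) set" where
  "labelled_P_partitions V P \<omega> =
     {\<kappa> \<in> extensional V. \<forall>(u, v)\<in>P. \<kappa> u < \<kappa> v \<or> \<kappa> u = \<kappa> v \<and> \<omega> u < \<omega> v}"

text \<open>Reading a colouring along an enumeration of the vertices gives an arbitrary word.\<close>

lemma bij_betw_map_extensional:
  assumes "distinct \<sigma>"
  shows "bij_betw (\<lambda>\<kappa>. map \<kappa> \<sigma>) {\<kappa> \<in> extensional (set \<sigma>). R (map \<kappa> \<sigma>)} {xs. length xs = length \<sigma> \<and> R xs}"
proof (rule bij_betwI')
  fix \<kappa> \<kappa>' :: "'a \<Rightarrow> 'b"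
  assume "\<kappa> \<in> {\<kappa> \<in> extensional (set \<sigma>). R (map \<kappa> \<sigma>)}" "\<kappa>' \<in> {\<kappa> \<in> extensional (set \<sigma>). R (map \<kappa> \<sigma>)}"
  then show "map \<kappa> \<sigma> = map \<kappa>' \<sigma> \<longleftrightarrow> \<kappa> = \<kappa>'"
    by (auto intro: extensionalityI)
next
  fix xs assume xs: "xs \<in> {xs. length xs = length \<sigma> \<and> R xs}"
  define \<kappa> where "\<kappa> = (\<lambda>v\<in>set \<sigma>. the (map_of (zip \<sigma> xs) v))"
  have "map \<kappa> \<sigma> = xs"
    using xs assms by (intro nth_equalityI) (auto simp: \<kappa>_def map_of_zip_nth)
  then show "\<exists>\<kappa>\<in>{\<kappa> \<in> extensional (set \<sigma>). R (map \<kappa> \<sigma>)}. xs = map \<kappa> \<sigma>"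
    using xs by (intro bexI[of _ \<kappa>]) (auto simp: \<kappa>_def)
qed auto

text \<open>
  Order the vertices by colour and then by label.  The defining condition of a \<open>(P, \<omega>)\<close>-partition says
  precisely that this order extends \<open>P\<close>.  Whether a colouring induces a given order \<open>\<sigma>\<close> only depends on
  the word of its colours along \<open>\<sigma>\<close>: the word must increase weakly, and strictly where the labels
  descend.  So the colourings inducing a linear extension \<open>\<sigma>\<close> have a fundamental quasi-symmetric
  function as generating function, and those inducing any other order are no \<open>(P, \<omega>)\<close>-partitions.
\<close>

theorem Q_positive_labelled_P_partitions:
  assumes V: "finite V" and P: "P \<subseteq> V \<times> V" and inj: "inj_on \<omega> V"
  shows "Q_positive (monomial_sum (labelled_P_partitions V P \<omega>) (colour_monomial V))"
proof -
  define A where "A = labelled_P_partitions V P \<omega>"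
  define d where "d = card V"
  define B where "B = Suc (sum \<omega> V)"
  have B: "\<omega> v < B" if "v \<in> V" for v
    using member_le_sum[OF that _ V, of \<omega>] by (simp add: B_def)
  \<comment> \<open>As all labels are below \<open>B\<close>, this key compares first by colour and then by label.\<close>
  define key where "key \<kappa> v = \<kappa> v * B + \<omega> v" for \<kappa> v
  have key_less: "key \<kappa> u < key \<kappa> v \<longleftrightarrow> \<kappa> u < \<kappa> v \<or> \<kappa> u = \<kappa> v \<and> \<omega> u < \<omega> v"
    if "u \<in> V" "v \<in> V" for \<kappa> u v
  proof -
    have less: "key \<kappa> x < key \<kappa> y" if "\<kappa> x < \<kappa> y" "x \<in> V" for x y
    proof -
      have "key \<kappa> x < Suc (\<kappa> x) * B" using B[OF that(2)] by (simp add: key_def)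
      also have "\<dots> \<le> \<kappa> y * B" using that(1) by (intro mult_le_mono1) simp
      finally show ?thesis by (simp add: key_def)
    qed
    show ?thesis
      using less[of u v] less[of v u] that by (cases "\<kappa> u" "\<kappa> v" rule: linorder_cases) (auto simp: key_def)
  qed
  have inj_key: "inj_on (key \<kappa>) V" for \<kappa>
  proof (rule inj_onI)
    fix u v assume uv: "u \<in> V" "v \<in> V" "key \<kappa> u = key \<kappa> v"
    then have "\<omega> u = \<omega> v"
      using key_less[of u v \<kappa>] key_less[of v u \<kappa>] by (metis nat_neq_iff)
    then show "u = v" using inj uv by (auto dest: inj_onD)
  qed
  obtain vs where vs: "set vs = V" "distinct vs" using V finite_distinct_list by blast
  define std where "std \<kappa> = sort_key (key \<kappa>) vs" for \<kappa>
  define orders where "orders = permutations_of_set V"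
  have orders: "set \<sigma> = V" "distinct \<sigma>" "length \<sigma> = d" "mset \<sigma> = mset_set V" if "\<sigma> \<in> orders" for \<sigma>
    using that by (auto simp: orders_def permutations_of_set_def d_def distinct_card mset_set_set)
  have std_orders: "std \<kappa> \<in> orders" for \<kappa>
    using vs by (auto simp: std_def orders_def permutations_of_set_def)
  define Des where "Des \<sigma> = {j \<in> {1..<d}. \<omega> (\<sigma> ! j) < \<omega> (\<sigma> ! (j - 1))}" for \<sigma>
  define W where "W \<sigma> = {xs :: nat list. length xs = d \<and> sorted xs \<and> (\<forall>j\<in>Des \<sigma>. xs ! (j - 1) < xs ! j)}" for \<sigma>
  have std_iff: "std \<kappa> = \<sigma> \<longleftrightarrow> sorted_wrt (<) (map (key \<kappa>) \<sigma>)" if \<sigma>: "\<sigma> \<in> orders" for \<kappa> \<sigma>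
  proof -
    have "mset vs = mset \<sigma>" using vs orders[OF \<sigma>] by (simp flip: mset_set_set)
    moreover have "distinct (map (key \<kappa>) \<sigma>)"
      using orders[OF \<sigma>] inj_key by (simp add: distinct_map)
    moreover have "sorted (map (key \<kappa>) (std \<kappa>))" by (simp add: std_def)
    ultimately show ?thesis
      using sort_key_inj_key_eq[of vs \<sigma> "key \<kappa>"] inj_key vs(1)
      by (auto simp: std_def strict_sorted_iff)
  qed
  have std_iff_W: "std \<kappa> = \<sigma> \<longleftrightarrow> map \<kappa> \<sigma> \<in> W \<sigma>" if \<sigma>: "\<sigma> \<in> orders" for \<kappa> \<sigma>
  proof -
    have nth: "\<sigma> ! j \<in> V" if "j < d" for j using orders[OF \<sigma>] that nth_mem by metis
    have step: "key \<kappa> (\<sigma> ! j) < key \<kappa> (\<sigma> ! Suc j)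
        \<longleftrightarrow> \<kappa> (\<sigma> ! j) \<le> \<kappa> (\<sigma> ! Suc j) \<and> (Suc j \<in> Des \<sigma> \<longrightarrow> \<kappa> (\<sigma> ! j) < \<kappa> (\<sigma> ! Suc j))"
      if j: "Suc j < d" for j
    proof -
      have "\<omega> (\<sigma> ! j) \<noteq> \<omega> (\<sigma> ! Suc j)"
        using inj nth[of j] nth[of "Suc j"] j orders[OF \<sigma>]
        by (auto simp: inj_on_eq_iff nth_eq_iff_index_eq)
      moreover have "key \<kappa> (\<sigma> ! j) < key \<kappa> (\<sigma> ! Suc j) \<longleftrightarrow> \<kappa> (\<sigma> ! j) < \<kappa> (\<sigma> ! Suc j)
          \<or> \<kappa> (\<sigma> ! j) = \<kappa> (\<sigma> ! Suc j) \<and> \<omega> (\<sigma> ! j) < \<omega> (\<sigma> ! Suc j)"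
        using key_less nth j by simp
      moreover have "Suc j \<in> Des \<sigma> \<longleftrightarrow> \<omega> (\<sigma> ! Suc j) < \<omega> (\<sigma> ! j)"
        using j by (simp add: Des_def)
      ultimately show ?thesis by linarith
    qed
    have "std \<kappa> = \<sigma> \<longleftrightarrow> (\<forall>j. Suc j < d \<longrightarrow> key \<kappa> (\<sigma> ! j) < key \<kappa> (\<sigma> ! Suc j))"
      using std_iff[OF \<sigma>] orders(3)[OF \<sigma>] by (simp add: sorted_wrt_iff_nth_Suc_transp)
    also have "\<dots> \<longleftrightarrow> (\<forall>j. Suc j < d \<longrightarrow> \<kappa> (\<sigma> ! j) \<le> \<kappa> (\<sigma> ! Suc j))
        \<and> (\<forall>j. Suc j < d \<longrightarrow> Suc j \<in> Des \<sigma> \<longrightarrow> \<kappa> (\<sigma> ! j) < \<kappa> (\<sigma> ! Suc j))"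
      using step by blast
    also have "(\<forall>j. Suc j < d \<longrightarrow> \<kappa> (\<sigma> ! j) \<le> \<kappa> (\<sigma> ! Suc j)) \<longleftrightarrow> sorted (map \<kappa> \<sigma>)"
      using orders(3)[OF \<sigma>] by (simp add: sorted_iff_nth_Suc)
    also have "(\<forall>j. Suc j < d \<longrightarrow> Suc j \<in> Des \<sigma> \<longrightarrow> \<kappa> (\<sigma> ! j) < \<kappa> (\<sigma> ! Suc j))
        \<longleftrightarrow> (\<forall>j\<in>Des \<sigma>. map \<kappa> \<sigma> ! (j - 1) < map \<kappa> \<sigma> ! j)"
    proof -
      have "j \<in> Des \<sigma> \<Longrightarrow> \<exists>i. j = Suc i \<and> Suc i < d" for j by (cases j) (auto simp: Des_def)
      then show ?thesis using orders(3)[OF \<sigma>] by (fastforce simp: Des_def)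
    qed
    finally show ?thesis using orders(3)[OF \<sigma>] by (simp add: W_def)
  qed
  define Lin where "Lin = {\<sigma> \<in> orders. \<forall>i<d. \<forall>j<d. (\<sigma> ! i, \<sigma> ! j) \<in> P \<longrightarrow> i < j}"
  have A_iff: "\<kappa> \<in> A \<longleftrightarrow> \<sigma> \<in> Lin" if "\<kappa> \<in> extensional V" "\<sigma> \<in> orders" "std \<kappa> = \<sigma>" for \<kappa> \<sigma>
  proof -
    have \<sigma>: "set \<sigma> = V" "length \<sigma> = d" using orders that by auto
    have sorted: "sorted_wrt (<) (map (key \<kappa>) \<sigma>)" using std_iff that by blast
    have pos: "key \<kappa> (\<sigma> ! i) < key \<kappa> (\<sigma> ! j) \<longleftrightarrow> i < j" if "i < d" "j < d" for i j
      using sorted_wrt_nth_less[OF sorted, of i j] sorted_wrt_nth_less[OF sorted, of j i] that \<sigma>(2)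
      by (cases i j rule: linorder_cases) auto
    have "\<kappa> \<in> A \<longleftrightarrow> (\<forall>(u, v)\<in>P. key \<kappa> u < key \<kappa> v)"
      using that(1) P key_less[of _ _ \<kappa>] by (fastforce simp: A_def labelled_P_partitions_def)
    also have "\<dots> \<longleftrightarrow> (\<forall>i<d. \<forall>j<d. (\<sigma> ! i, \<sigma> ! j) \<in> P \<longrightarrow> key \<kappa> (\<sigma> ! i) < key \<kappa> (\<sigma> ! j))"
    proof
      assume *: "\<forall>i<d. \<forall>j<d. (\<sigma> ! i, \<sigma> ! j) \<in> P \<longrightarrow> key \<kappa> (\<sigma> ! i) < key \<kappa> (\<sigma> ! j)"
      show "\<forall>(u, v)\<in>P. key \<kappa> u < key \<kappa> v"
      proof safe
        fix u v assume uv: "(u, v) \<in> P"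
        then have "u \<in> set \<sigma>" "v \<in> set \<sigma>" using P \<sigma> by auto
        then obtain i j where "i < d" "u = \<sigma> ! i" "j < d" "v = \<sigma> ! j"
          using \<sigma>(2) by (metis in_set_conv_nth)
        with * uv show "key \<kappa> u < key \<kappa> v" by blast
      qed
    qed auto
    also have "\<dots> \<longleftrightarrow> \<sigma> \<in> Lin" using pos that(2) by (auto simp: Lin_def)
    finally show ?thesis .
  qed
  have fin: "finite orders" by (simp add: orders_def)
  have fibre: "monomial_sum {\<kappa> \<in> A. std \<kappa> = \<sigma>} (colour_monomial V) M = fundamental_Q (Des \<sigma>) d M"
    if \<sigma>: "\<sigma> \<in> Lin" for \<sigma> M
  proof -
    have ord: "\<sigma> \<in> orders" using \<sigma> by (simp add: Lin_def)
    have "{\<kappa> \<in> {\<kappa> \<in> A. std \<kappa> = \<sigma>}. colour_monomial V \<kappa> = M}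
        = {\<kappa> \<in> extensional V. map \<kappa> \<sigma> \<in> W \<sigma> \<and> mset (map \<kappa> \<sigma>) = M}"
      using A_iff[OF _ ord] \<sigma> std_iff_W[OF ord] orders(4)[OF ord]
      by (auto simp: colour_monomial_def A_def labelled_P_partitions_def)
    moreover have "bij_betw (\<lambda>\<kappa>. map \<kappa> \<sigma>) {\<kappa> \<in> extensional V. map \<kappa> \<sigma> \<in> W \<sigma> \<and> mset (map \<kappa> \<sigma>) = M}
        {xs. length xs = length \<sigma> \<and> xs \<in> W \<sigma> \<and> mset xs = M}"
      using bij_betw_map_extensional[of \<sigma> "\<lambda>xs. xs \<in> W \<sigma> \<and> mset xs = M"] orders[OF ord] by simp
    moreover have "{xs. length xs = length \<sigma> \<and> xs \<in> W \<sigma> \<and> mset xs = M} = {xs \<in> W \<sigma>. mset xs = M}"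
      using orders(3)[OF ord] by (auto simp: W_def)
    ultimately have "card {\<kappa> \<in> {\<kappa> \<in> A. std \<kappa> = \<sigma>}. colour_monomial V \<kappa> = M} = card {xs \<in> W \<sigma>. mset xs = M}"
      by (simp add: bij_betw_same_card)
    then show ?thesis by (simp add: monomial_sum_def fundamental_Q_def W_def)
  qed
  have "monomial_sum A (colour_monomial V) M = (\<Sum>\<sigma>\<in>Lin. fundamental_Q (Des \<sigma>) d M)" for M
  proof -
    have "monomial_sum A (colour_monomial V) M
        = (\<Sum>\<sigma>\<in>orders. monomial_sum {\<kappa> \<in> A. std \<kappa> = \<sigma>} (colour_monomial V) M)"
    proof (rule monomial_sum_fibres[OF fin])
      show "finite {\<kappa> \<in> A. colour_monomial V \<kappa> = M}"
        by (rule finite_subset[OF _ finite_colourings[OF V, of M]]) (auto simp: A_def labelled_P_partitions_def)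
    qed (use std_orders in auto)
    also have "\<dots> = (\<Sum>\<sigma>\<in>Lin. monomial_sum {\<kappa> \<in> A. std \<kappa> = \<sigma>} (colour_monomial V) M)"
    proof (rule sum.mono_neutral_right[OF fin])
      show "\<forall>\<sigma>\<in>orders - Lin. monomial_sum {\<kappa> \<in> A. std \<kappa> = \<sigma>} (colour_monomial V) M = 0"
      proof
        fix \<sigma> assume "\<sigma> \<in> orders - Lin"
        then have "{\<kappa> \<in> A. std \<kappa> = \<sigma>} = {}"
          using A_iff by (auto simp: A_def labelled_P_partitions_def)
        then show "monomial_sum {\<kappa> \<in> A. std \<kappa> = \<sigma>} (colour_monomial V) M = 0"
          by (simp only: monomial_sum_def) simp
      qed
    qed (auto simp: Lin_def)
    finally show ?thesis using fibre by simp
  qed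
  then have "monomial_sum A (colour_monomial V) = (\<lambda>M. \<Sum>\<sigma>\<in>Lin. fundamental_Q (Des \<sigma>) d M)" by blast
  moreover have "positive_in {(S, d). S \<subseteq> {1..<d}} (\<lambda>(S, d). fundamental_Q S d)
      (\<lambda>M. \<Sum>\<sigma>\<in>Lin. fundamental_Q (Des \<sigma>) d M)"
  proof (rule positive_in_sum)
    show "finite Lin" using fin by (simp add: Lin_def)
    show "positive_in {(S, d). S \<subseteq> {1..<d}} (\<lambda>(S, d). fundamental_Q S d) (fundamental_Q (Des \<sigma>) d)" for \<sigma>
    proof -
      have "(Des \<sigma>, d) \<in> {(S, d). S \<subseteq> {1..<d}}" by (auto simp: Des_def)
      from positive_in_single[OF this, of "\<lambda>(S, d). fundamental_Q S d"] show ?thesis by simp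
    qed
  qed
  ultimately show ?thesis by (simp add: Q_positive_def A_def)
qed

section \<open>Chromatic symmetric functions\<close>

definition proper_colourings :: "'a pair_pre_digraph \<Rightarrow> ('a \<Rightarrow> nat) set" where
  "proper_colourings G = {\<kappa> \<in> extensional (pverts G). \<forall>(u, v)\<in>parcs G. \<kappa> u \<noteq> \<kappa> v}"

text \<open>
  Direct each edge from its smaller to its larger colour.  The proper colourings that induce a given
  orientation \<open>R\<close> are the colourings increasing strictly along \<open>R\<close>.  They are \<open>(R, \<omega>)\<close>-partitions for any
  labelling \<open>\<omega>\<close> that decreases along \<open>R\<close>, because then constant colours are never allowed.
\<close>

theorem Q_positive_proper_colourings:
  assumes "pair_graph G"
  shows "Q_positive (monomial_sum (proper_colourings G) (colour_monomial (pverts G)))"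
proof -
  interpret pair_graph G by fact
  define V where "V = pverts G"
  have V: "finite V" by (simp add: V_def)
  have arcs_V: "parcs G \<subseteq> V \<times> V" using arc_fst_in_verts arc_snd_in_verts by (fastforce simp: V_def)
  have arcs_sym: "(v, u) \<in> parcs G" if "(u, v) \<in> parcs G" for u v
    using that pair_sym_arcs by (simp add: symmetric_def symD)
  define orient where "orient \<kappa> = {(u, v) \<in> parcs G. \<kappa> u < (\<kappa> v :: nat)}" for \<kappa>
  define Os where "Os = orient ` proper_colourings G"
  have fin_Os: "finite Os"
    by (rule finite_subset[of _ "Pow (parcs G)"]) (auto simp: Os_def orient_def)
  have pos: "Q_positive (monomial_sum {\<kappa> \<in> proper_colourings G. orient \<kappa> = R} (colour_monomial V))"
    if "R \<in> Os" for R
  proof -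
    obtain \<kappa>0 where \<kappa>0: "\<kappa>0 \<in> proper_colourings G" "R = orient \<kappa>0" using \<open>R \<in> Os\<close> by (auto simp: Os_def)
    obtain l :: "'a \<Rightarrow> nat" where l: "bij_betw l V {0..<card V}" using ex_bij_betw_finite_nat[OF V] by blast
    define r where "r v = \<kappa>0 v * card V + l v" for v
    have l_less: "l v < card V" if "v \<in> V" for v using l that by (auto simp: bij_betw_def)
    have r_inj: "inj_on r V"
    proof (rule inj_onI)
      fix u v assume uv: "u \<in> V" "v \<in> V" "r u = r v"
      then have "r u mod card V = r v mod card V" by simp
      then have "l u = l v" using l_less uv by (simp add: r_def)
      then show "u = v" using l uv by (auto simp: bij_betw_def dest: inj_onD)
    qed
    have r_less: "r u < r v" if "\<kappa>0 u < \<kappa>0 v" "u \<in> V" for u v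
    proof -
      have "r u < Suc (\<kappa>0 u) * card V" using l_less[OF that(2)] by (simp add: r_def)
      also have "\<dots> \<le> \<kappa>0 v * card V" using that(1) by (intro mult_le_mono1) simp
      finally show ?thesis by (simp add: r_def)
    qed
    \<comment> \<open>The rank \<open>r\<close> refines the order of the colours of a witness \<open>\<kappa>0\<close> to an injection, so it increases
      along \<open>R\<close>; subtracting it from an upper bound reverses it.\<close>
    define \<omega> where "\<omega> v = sum r V - r v" for v
    have r_le: "r v \<le> sum r V" if "v \<in> V" for v using member_le_sum[OF that _ V, of r] by simp
    have \<omega>_inj: "inj_on \<omega> V"
      using r_inj r_le by (auto simp: \<omega>_def inj_on_def) (metis diff_diff_cancel)
    have \<omega>_less: "\<omega> v < \<omega> u" if "(u, v) \<in> R" for u v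
    proof -
      have uv: "u \<in> V" "v \<in> V" "\<kappa>0 u < \<kappa>0 v" using that \<kappa>0(2) arcs_V by (auto simp: orient_def)
      then show ?thesis using r_less[of u v] r_le[of v] by (simp add: \<omega>_def)
    qed
    have R_V: "R \<subseteq> V \<times> V" using \<kappa>0 arcs_V by (auto simp: orient_def)
    have "{\<kappa> \<in> proper_colourings G. orient \<kappa> = R} = labelled_P_partitions V R \<omega>"
    proof (intro equalityI subsetI)
      fix \<kappa> assume "\<kappa> \<in> {\<kappa> \<in> proper_colourings G. orient \<kappa> = R}"
      then show "\<kappa> \<in> labelled_P_partitions V R \<omega>"
        by (auto simp: proper_colourings_def labelled_P_partitions_def orient_def V_def)
    next
      fix \<kappa> assume \<kappa>: "\<kappa> \<in> labelled_P_partitions V R \<omega>"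
      have less: "\<kappa> u < \<kappa> v" if "(u, v) \<in> R" for u v
        using \<kappa> that \<omega>_less[OF that] by (auto simp: labelled_P_partitions_def)
      have total: "(u, v) \<in> R \<or> (v, u) \<in> R" if "(u, v) \<in> parcs G" for u v
      proof -
        have "\<kappa>0 u \<noteq> \<kappa>0 v" using \<kappa>0(1) that by (auto simp: proper_colourings_def)
        then show ?thesis using that arcs_sym[OF that] by (auto simp: \<kappa>0(2) orient_def)
      qed
      have "\<kappa> \<in> proper_colourings G"
        using \<kappa> less total by (fastforce simp: proper_colourings_def labelled_P_partitions_def V_def)
      moreover have "orient \<kappa> = R"
      proof (intro equalityI subrelI)
        fix u v assume "(u, v) \<in> orient \<kappa>"
        then show "(u, v) \<in> R" using total[of u v] less[of v u] by (auto simp: orient_def)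
      next
        fix u v assume "(u, v) \<in> R"
        then show "(u, v) \<in> orient \<kappa>" using less[of u v] \<kappa>0(2) by (auto simp: orient_def)
      qed
      ultimately show "\<kappa> \<in> {\<kappa> \<in> proper_colourings G. orient \<kappa> = R}" by simp
    qed
    then show ?thesis using Q_positive_labelled_P_partitions[OF V R_V \<omega>_inj] by simp
  qed
  have "monomial_sum (proper_colourings G) (colour_monomial V) M
      = (\<Sum>R\<in>Os. monomial_sum {\<kappa> \<in> proper_colourings G. orient \<kappa> = R} (colour_monomial V) M)" for M
  proof (rule monomial_sum_fibres[OF fin_Os])
    show "finite {\<kappa> \<in> proper_colourings G. colour_monomial V \<kappa> = M}"
      by (rule finite_subset[OF _ finite_colourings[OF V, of M]]) (auto simp: proper_colourings_def V_def)
  qed (simp add: Os_def)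
  then have eq: "monomial_sum (proper_colourings G) (colour_monomial V)
      = (\<lambda>M. \<Sum>R\<in>Os. monomial_sum {\<kappa> \<in> proper_colourings G. orient \<kappa> = R} (colour_monomial V) M)" by blast
  show ?thesis unfolding V_def[symmetric] eq Q_positive_def
    by (rule positive_in_sum[OF fin_Os]) (use pos in \<open>simp add: Q_positive_def\<close>)
qed

text \<open>
  Such a colouring numbers the blocks of \<open>P\<close> by \<open>0, \<dots>, k - 1\<close>, so it amounts to a listing of the blocks.
\<close>

lemma card_packed_colourings:
  assumes V: "finite V" and P: "partition_on V P"
  shows "card {\<kappa> \<in> extensional V. level_sets \<kappa> V = P \<and> (\<exists>k :: nat. \<kappa> ` V = {..<k})} = fact (card P)"
proof -
  define k where "k = card P"
  have finP: "finite P" using finite_elements[OF V P] .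
  have P_cover: "\<exists>B\<in>P. v \<in> B" if "v \<in> V" for v using P that by (auto simp: partition_on_def)
  have P_sub: "B \<subseteq> V" "B \<noteq> {}" if "B \<in> P" for B using P that by (auto simp: partition_on_def)
  have P_disj: "B = C" if "B \<in> P" "C \<in> P" "v \<in> B" "v \<in> C" for B C v
    using P that unfolding partition_on_def disjoint_def by blast
  let ?K = "{\<kappa> \<in> extensional V. level_sets \<kappa> V = P \<and> (\<exists>k :: nat. \<kappa> ` V = {..<k})}"
  have range: "\<kappa> ` V = {..<k}" "P = (\<lambda>i. {v \<in> V. \<kappa> v = i}) ` {..<k}" if K: "\<kappa> \<in> ?K" for \<kappa>
  proof -
    obtain n where n: "\<kappa> ` V = {..<n}" using K by blast
    have "level_sets \<kappa> V = (\<lambda>i. {v \<in> V. \<kappa> v = i}) ` \<kappa> ` V" by (auto simp: level_sets_def)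
    then have P_eq: "P = (\<lambda>i. {v \<in> V. \<kappa> v = i}) ` \<kappa> ` V" using K by simp
    have "inj_on (\<lambda>i. {v \<in> V. \<kappa> v = i}) (\<kappa> ` V)" by (auto simp: inj_on_def)
    then have "k = n" unfolding k_def P_eq by (subst card_image) (simp_all add: n)
    then show "\<kappa> ` V = {..<k}" "P = (\<lambda>i. {v \<in> V. \<kappa> v = i}) ` {..<k}"
      using n P_eq by simp_all
  qed
  have "bij_betw (\<lambda>\<kappa>. map (\<lambda>i. {v \<in> V. \<kappa> v = i}) [0..<k]) ?K (permutations_of_set P)"
  proof (rule bij_betwI')
    fix \<kappa> \<kappa>' assume K: "\<kappa> \<in> ?K" "\<kappa>' \<in> ?K"
    show "map (\<lambda>i. {v \<in> V. \<kappa> v = i}) [0..<k] = map (\<lambda>i. {v \<in> V. \<kappa>' v = i}) [0..<k] \<longleftrightarrow> \<kappa> = \<kappa>'"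
    proof
      assume "map (\<lambda>i. {v \<in> V. \<kappa> v = i}) [0..<k] = map (\<lambda>i. {v \<in> V. \<kappa>' v = i}) [0..<k]"
      then have eq: "{v \<in> V. \<kappa> v = i} = {v \<in> V. \<kappa>' v = i}" if "i < k" for i
        using that by simp
      have "\<kappa> v = \<kappa>' v" if "v \<in> V" for v
      proof -
        have "\<kappa> v < k" using range(1)[OF K(1)] that by (metis imageI lessThan_iff)
        moreover have "v \<in> {u \<in> V. \<kappa> u = \<kappa> v}" using that by simp
        ultimately have "v \<in> {u \<in> V. \<kappa>' u = \<kappa> v}" using eq by blast
        then show ?thesis by simp
      qed
      then show "\<kappa> = \<kappa>'" using K by (auto intro: extensionalityI)
    qed simp
  next
    fix \<kappa> assume K: "\<kappa> \<in> ?K"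
    have "inj_on (\<lambda>i. {v \<in> V. \<kappa> v = i}) {0..<k}"
    proof (rule inj_onI)
      fix i j assume ij: "i \<in> {0..<k}" "{v \<in> V. \<kappa> v = i} = {v \<in> V. \<kappa> v = j}"
      then have "i \<in> \<kappa> ` V" using range(1)[OF K] by auto
      then obtain v where "v \<in> {v \<in> V. \<kappa> v = i}" by blast
      then have "\<kappa> v = i" "v \<in> {v \<in> V. \<kappa> v = j}" using ij(2) by auto
      then show "i = j" by simp
    qed
    then show "map (\<lambda>i. {v \<in> V. \<kappa> v = i}) [0..<k] \<in> permutations_of_set P"
      using range(2)[OF K] by (simp add: permutations_of_set_def distinct_map atLeast0LessThan)
  next
    fix ps assume "ps \<in> permutations_of_set P"
    then have ps: "set ps = P" "distinct ps" by (auto simp: permutations_of_set_def)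
    have len: "length ps = k" using ps by (simp add: k_def flip: distinct_card)
    define \<kappa> where "\<kappa> = (\<lambda>v\<in>V. THE i. i < k \<and> v \<in> ps ! i)"
    have \<kappa>: "\<kappa> v = i" if "i < k" "v \<in> ps ! i" for i v
    proof -
      have "ps ! i \<in> P" using that ps len by auto
      then have "v \<in> V" using P_sub that by blast
      moreover have "(THE i. i < k \<and> v \<in> ps ! i) = i"
      proof (rule the_equality)
        fix j assume "j < k \<and> v \<in> ps ! j"
        then show "j = i" using P_disj[of "ps ! j" "ps ! i" v] that ps len
          by (metis nth_eq_iff_index_eq nth_mem)
      qed (use that in simp)
      ultimately show ?thesis by (simp add: \<kappa>_def)
    qed
    have ex: "\<exists>i<k. v \<in> ps ! i" if v: "v \<in> V" for v
      using P_cover[OF v] ps len by (metis in_set_conv_nth)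
    have level: "{v \<in> V. \<kappa> v = i} = ps ! i" if i: "i < k" for i
    proof -
      have "ps ! i \<in> P" using i ps len by auto
      then show ?thesis using P_sub \<kappa>[OF i] ex \<kappa> by blast
    qed
    have img: "\<kappa> ` V = {..<k}"
    proof (intro equalityI subsetI)
      fix i assume "i \<in> \<kappa> ` V"
      then show "i \<in> {..<k}" using ex \<kappa> by blast
    next
      fix i assume i: "i \<in> {..<k}"
      then have "ps ! i \<in> P" using ps len by auto
      then obtain v where "v \<in> ps ! i" using P_sub(2) by blast
      then have "v \<in> V \<and> \<kappa> v = i" using level[of i] i by blast
      then show "i \<in> \<kappa> ` V" by blast
    qed
    have "level_sets \<kappa> V = (\<lambda>i. {v \<in> V. \<kappa> v = i}) ` \<kappa> ` V" by (auto simp: level_sets_def)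
    also have "\<dots> = (\<lambda>i. ps ! i) ` {..<k}" unfolding img by (rule image_cong) (use level in auto)
    also have "\<dots> = P" using ps len by (auto simp: set_conv_nth)
    finally have "\<kappa> \<in> ?K" using img by (auto simp: \<kappa>_def)
    moreover have "ps = map (\<lambda>i. {v \<in> V. \<kappa> v = i}) [0..<k]"
      using level len by (intro nth_equalityI) auto
    ultimately show "\<exists>\<kappa>\<in>?K. ps = map (\<lambda>i. {v \<in> V. \<kappa> v = i}) [0..<k]" by blast
  qed
  from bij_betw_same_card[OF this] show ?thesis using finP by simp
qed

lemma stable_partition_level_sets:
  assumes "pair_graph G" "\<kappa> \<in> extensional (pverts G)"
  shows "stable_partition G (level_sets \<kappa> (pverts G)) \<longleftrightarrow> \<kappa> \<in> proper_colourings G"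
proof -
  interpret pair_graph G by fact
  have part: "partition_on (pverts G) (level_sets \<kappa> (pverts G))"
    by (auto simp: partition_on_def level_sets_def disjoint_def)
  have "(\<forall>B\<in>level_sets \<kappa> (pverts G). \<forall>u\<in>B. \<forall>v\<in>B. (u, v) \<notin> parcs G) \<longleftrightarrow> (\<forall>(u, v)\<in>parcs G. \<kappa> u \<noteq> \<kappa> v)"
  proof (intro iffI)
    assume *: "\<forall>B\<in>level_sets \<kappa> (pverts G). \<forall>u\<in>B. \<forall>v\<in>B. (u, v) \<notin> parcs G"
    show "\<forall>(u, v)\<in>parcs G. \<kappa> u \<noteq> \<kappa> v"
    proof safe
      fix u v assume uv: "(u, v) \<in> parcs G" "\<kappa> u = \<kappa> v"
      then have "u \<in> pverts G" "v \<in> pverts G" using arc_fst_in_verts arc_snd_in_verts by fastforce+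
      with * uv show False by (auto simp: level_sets_def)
    qed
  qed (fastforce simp: level_sets_def)
  with part assms(2) show ?thesis by (simp add: stable_partition_def proper_colourings_def)
qed

text \<open>
  Up to the common denominator, both coefficients at \<open>M\<close> count the proper colourings whose monomial is
  packed and has the exponents of \<open>M\<close>.  On the left they are grouped by their level sets, a stable
  partition with \<open>k\<close> blocks occurring \<open>k!\<close> times.
\<close>

theorem chromatic_sf_eq_symmetrization:
  assumes "pair_graph G"
  shows "chromatic_sf G =
    symmetrization (monomial_sum (proper_colourings G) (colour_monomial (pverts G)))"
proof
  fix M
  interpret pair_graph G by fact
  define V where "V = pverts G"
  have V: "finite V" by (simp add: V_def)
  define N where "N = exponents M"
  define SP where "SP = {P. stable_partition G P}"
  let ?w = "colour_monomial V"
  have fin_SP: "finite SP"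
    by (rule finite_subset[of _ "Pow (Pow V)"]) (use V in \<open>auto simp: SP_def stable_partition_def partition_on_def V_def\<close>)
  let ?K = "{\<kappa> \<in> proper_colourings G. ?w \<kappa> \<in> packed_monomials N}"
  have fin: "finite {\<kappa> \<in> proper_colourings G. ?w \<kappa> = M'}" for M'
    by (rule finite_subset[OF _ finite_colourings[OF V, of M']]) (auto simp: proper_colourings_def V_def)
  have fin_N: "finite (packed_monomials N)" unfolding N_def by (rule finite_packed_monomials)
  have K_UN: "?K = (\<Union>M'\<in>packed_monomials N. {\<kappa> \<in> proper_colourings G. ?w \<kappa> = M'})" by auto
  have fin_K: "finite ?K" unfolding K_UN using fin fin_N by blast
  have "(\<Sum>M'\<in>packed_monomials N. card {\<kappa> \<in> proper_colourings G. ?w \<kappa> = M'}) = card ?K"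
    unfolding K_UN by (rule card_UN_disjoint[symmetric]) (use fin fin_N in auto)
  also have "?K = (\<Union>P\<in>SP. {\<kappa> \<in> ?K. level_sets \<kappa> V = P})"
    using stable_partition_level_sets[OF assms]
    by (auto simp: SP_def V_def proper_colourings_def)
  also have "card \<dots> = (\<Sum>P\<in>SP. card {\<kappa> \<in> ?K. level_sets \<kappa> V = P})"
    by (rule card_UN_disjoint) (use fin_SP in \<open>auto intro: finite_subset[OF _ fin_K]\<close>)
  also have "\<dots> = (\<Sum>P\<in>SP. if block_sizes P = N then fact (card P) else 0)"
  proof (rule sum.cong)
    fix P assume P: "P \<in> SP"
    have "\<kappa> \<in> ?K \<and> level_sets \<kappa> V = P \<longleftrightarrow>
        \<kappa> \<in> extensional V \<and> level_sets \<kappa> V = P \<and> (\<exists>k. \<kappa> ` V = {..<k}) \<and> block_sizes P = N" for \<kappa>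
      using stable_partition_level_sets[OF assms, of \<kappa>] block_sizes_level_sets[OF V, of \<kappa>] P V
      by (auto simp: SP_def packed_monomials_def colour_monomial_def proper_colourings_def V_def)
    then have "{\<kappa> \<in> ?K. level_sets \<kappa> V = P} = (if block_sizes P = N
        then {\<kappa> \<in> extensional V. level_sets \<kappa> V = P \<and> (\<exists>k. \<kappa> ` V = {..<k})} else {})"
      by auto
    moreover have "partition_on V P" using P by (simp add: SP_def stable_partition_def V_def)
    ultimately show "card {\<kappa> \<in> ?K. level_sets \<kappa> V = P} = (if block_sizes P = N then fact (card P) else 0)"
      using card_packed_colourings[OF V] by simp
  qed simp
  finally have "(\<Sum>M'\<in>packed_monomials N. monomial_sum (proper_colourings G) ?w M')
      = (\<Sum>P\<in>SP. if block_sizes P = N then fact (card P) else 0)"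
    by (simp add: monomial_sum_def of_nat_sum[symmetric] del: of_nat_sum) (simp add: if_distrib cong: if_cong)
  moreover have "chromatic_sf G M
      = (\<Sum>P\<in>SP. (if block_sizes P = N then fact (card P) else 0) / of_nat (card (packed_monomials N)))"
    unfolding chromatic_sf_def SP_def
    by (intro sum.cong refl) (auto simp: aug_monomial_sf_eq N_def simp flip: size_block_sizes)
  ultimately show "chromatic_sf G M =
      symmetrization (monomial_sum (proper_colourings G) (colour_monomial (pverts G))) M"
    by (simp add: symmetrization_def sum_divide_distrib[where A = SP] flip: N_def V_def)
qed

section \<open>Schur functions\<close>

lemma diagram_Suc_row: "(Suc i, j) \<in> diagram \<mu> \<Longrightarrow> (i, j) \<in> diagram \<mu>"
proof -
  assume a: "(Suc i, j) \<in> diagram \<mu>"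
  have "sorted_wrt (\<ge>) (parts \<mu>)" by (simp add: parts_def sorted_wrt_rev)
  with a have "parts \<mu> ! Suc i \<le> parts \<mu> ! i"
    by (auto simp: diagram_def length_parts intro: sorted_wrt_nth_less)
  with a show ?thesis by (auto simp: diagram_def)
qed

text \<open>
  For the diagram with its covering relations, a labelling that increases along rows and decreases
  down columns allows equal entries exactly between neighbours in a row.
\<close>

theorem Q_positive_schur: "Q_positive (schur \<mu>)"
proof -
  define m where "m = Suc (sum_mset \<mu>)"
  \<comment> \<open>The labelling reads the rows from the bottom to the top, each from left to right; \<open>m\<close> exceeds the
    length of every row.\<close>
  define \<omega> where "\<omega> = (\<lambda>(i, j). (size \<mu> - i) * m + j)"
  define P where "P = {((i, j), (i, Suc j)) |i j. (i, j) \<in> diagram \<mu> \<and> (i, Suc j) \<in> diagram \<mu>}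
    \<union> {((i, j), (Suc i, j)) |i j. (i, j) \<in> diagram \<mu> \<and> (Suc i, j) \<in> diagram \<mu>}"
  have col: "j < m" "i < size \<mu>" if "(i, j) \<in> diagram \<mu>" for i j
  proof -
    show i: "i < size \<mu>" using that by (simp add: diagram_def)
    have "parts \<mu> ! i \<in># \<mu>"
      using nth_mem_mset[of i "parts \<mu>"] i by (simp add: length_parts mset_parts)
    then obtain \<nu> where "\<mu> = add_mset (parts \<mu> ! i) \<nu>" by (metis multi_member_split)
    then have "sum_mset \<mu> = parts \<mu> ! i + sum_mset \<nu>" by (metis sum_mset.add_mset)
    then have "parts \<mu> ! i \<le> sum_mset \<mu>" by simp
    then show "j < m" using that by (simp add: diagram_def m_def)
  qed
  have "inj_on \<omega> (diagram \<mu>)"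
  proof (rule inj_onI, clarsimp simp: \<omega>_def)
    fix i j i' j' assume *: "(i, j) \<in> diagram \<mu>" "(i', j') \<in> diagram \<mu>"
      "(size \<mu> - i) * m + j = (size \<mu> - i') * m + j'"
    have "((size \<mu> - i) * m + j) mod m = j" "((size \<mu> - i') * m + j') mod m = j'"
      using col[OF *(1)] col[OF *(2)] by simp_all
    then have "j = j'" using *(3) by simp
    with * have "(size \<mu> - i) * m = (size \<mu> - i') * m" by simp
    then have "size \<mu> - i = size \<mu> - i'" unfolding mult_cancel2 by (simp add: m_def)
    with \<open>j = j'\<close> col[OF *(1)] col[OF *(2)] show "i = i' \<and> j = j'" by simp
  qed
  moreover have "P \<subseteq> diagram \<mu> \<times> diagram \<mu>" by (auto simp: P_def)
  moreover have "labelled_P_partitions (diagram \<mu>) P \<omega> = semistandard_tableaux \<mu>"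
  proof -
    have row: "\<omega> (i, j) < \<omega> (i, Suc j)" for i j by (simp add: \<omega>_def)
    have column: "\<not> \<omega> (i, j) < \<omega> (Suc i, j)" for i j
      by (simp add: \<omega>_def not_less mult_le_mono1 diff_le_mono2)
    have "T \<in> labelled_P_partitions (diagram \<mu>) P \<omega> \<longleftrightarrow> T \<in> semistandard_tableaux \<mu>" for T
      using row column
      by (auto simp: labelled_P_partitions_def semistandard_tableaux_def P_def split_paired_all le_eq_less_or_eq) blast+
    then show ?thesis by blast
  qed
  ultimately show ?thesis
    using Q_positive_labelled_P_partitions[OF finite_diagram, of P \<mu> \<omega>]
    by (simp add: schur_def colour_monomial_def[abs_def])
qed

text \<open>
  For fixed \<open>T\<close> these numbers form the Gelfand--Tsetlin pattern of \<open>T\<close>: for each bound \<open>k\<close>, the row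
  lengths of the shape formed by the entries less than \<open>k\<close>.
\<close>

definition row_count :: "nat multiset \<Rightarrow> (nat \<times> nat \<Rightarrow> nat) \<Rightarrow> nat \<Rightarrow> nat \<Rightarrow> nat" where
  "row_count \<mu> T k i = card {j. (i, j) \<in> diagram \<mu> \<and> T (i, j) < k}"

lemma row_count_outside: "size \<mu> \<le> i \<Longrightarrow> row_count \<mu> T k i = 0"
  by (simp add: row_count_def diagram_def)

lemma row_mono:
  assumes "T \<in> semistandard_tableaux \<mu>" "(i, j') \<in> diagram \<mu>" "j \<le> j'"
  shows "T (i, j) \<le> T (i, j')"
  using assms(3,2)
proof (induction j' rule: dec_induct)
  case (step n)
  then have "(i, n) \<in> diagram \<mu>" by (auto simp: diagram_def)
  then show ?case using step assms(1) unfolding semistandard_tableaux_def by fastforce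
qed simp

lemma less_row_count_iff:
  assumes "T \<in> semistandard_tableaux \<mu>"
  shows "j < row_count \<mu> T k i \<longleftrightarrow> (i, j) \<in> diagram \<mu> \<and> T (i, j) < k"
proof -
  have "j \<in> {j. (i, j) \<in> diagram \<mu> \<and> T (i, j) < k} \<longleftrightarrow> j < card {j. (i, j) \<in> diagram \<mu> \<and> T (i, j) < k}"
  proof (rule mem_downset_iff)
    show "finite {j. (i, j) \<in> diagram \<mu> \<and> T (i, j) < k}" by (rule finite_subset[of _ "{..<parts \<mu> ! i}"]) (auto simp: diagram_def)
  next
    fix a b assume ab: "b \<in> {j. (i, j) \<in> diagram \<mu> \<and> T (i, j) < k}" "a < b"
    then have "(i, a) \<in> diagram \<mu>" by (auto simp: diagram_def)
    moreover have "T (i, a) \<le> T (i, b)" using row_mono[OF assms, of i b a] ab by simp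
    ultimately show "a \<in> {j. (i, j) \<in> diagram \<mu> \<and> T (i, j) < k}" using ab by auto
  qed
  then show ?thesis by (simp add: row_count_def)
qed

lemma row_count_mono:
  assumes "T \<in> semistandard_tableaux \<mu>" "k \<le> k'"
  shows "row_count \<mu> T k i \<le> row_count \<mu> T k' i"
  using less_row_count_iff[OF assms(1)] assms(2) by (meson leI le_less_trans less_le_trans less_irrefl)

text \<open>
  This is the strictness of the columns.  Together with \<open>row_count_mono\<close> it is the interlacing of
  consecutive shapes; conversely \<open>semistandard_tableauxI\<close> recovers the tableau conditions from it.
\<close>

lemma row_count_Suc_le:
  assumes T: "T \<in> semistandard_tableaux \<mu>"
  shows "row_count \<mu> T (Suc k) (Suc i) \<le> row_count \<mu> T k i"
proof (rule ccontr)
  assume "\<not> ?thesis"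
  then have "row_count \<mu> T k i < row_count \<mu> T (Suc k) (Suc i)" (is "?j < _") by simp
  then have a: "(Suc i, ?j) \<in> diagram \<mu>" "T (Suc i, ?j) < Suc k" using less_row_count_iff[OF T] by auto
  then have b: "(i, ?j) \<in> diagram \<mu>" using diagram_Suc_row by blast
  then have "T (i, ?j) < T (Suc i, ?j)" using a T by (simp add: semistandard_tableaux_def)
  then have "?j < row_count \<mu> T k i" using less_row_count_iff[OF T, of ?j k i] a b by auto
  then show False by simp
qed

lemma semistandard_tableauxI:
  assumes ext: "T \<in> extensional (diagram \<mu>)"
    and C: "\<And>i j k. (i, j) \<in> diagram \<mu> \<Longrightarrow> T (i, j) < k \<longleftrightarrow> j < C k i"
    and interlace: "\<And>i k. C (Suc k) (Suc i) \<le> C k i"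
  shows "T \<in> semistandard_tableaux \<mu>"
proof -
  have "T (i, j) \<le> T (i, Suc j)" if "(i, j) \<in> diagram \<mu>" "(i, Suc j) \<in> diagram \<mu>" for i j
  proof -
    have "Suc j < C (Suc (T (i, Suc j))) i" using C[OF that(2)] by blast
    then have "T (i, j) < Suc (T (i, Suc j))" using C[OF that(1)] by simp
    then show ?thesis by simp
  qed
  moreover have "T (i, j) < T (Suc i, j)" if "(i, j) \<in> diagram \<mu>" "(Suc i, j) \<in> diagram \<mu>" for i j
  proof -
    have "j < C (Suc (T (Suc i, j))) (Suc i)" using C[OF that(2)] by blast
    then have "j < C (T (Suc i, j)) i" using interlace order_less_le_trans by blast
    then show ?thesis using C[OF that(1)] by simp
  qed
  ultimately show ?thesis using ext by (simp add: semistandard_tableaux_def)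
qed

lemma tableau_eqI:
  assumes "T \<in> semistandard_tableaux \<mu>" "T' \<in> semistandard_tableaux \<mu>" "row_count \<mu> T = row_count \<mu> T'"
  shows "T = T'"
proof (rule extensionalityI[of _ "diagram \<mu>"])
  fix v assume v: "v \<in> diagram \<mu>"
  obtain i j where ij: "v = (i, j)" by fastforce
  have "T v < k \<longleftrightarrow> T' v < k" for k
    using less_row_count_iff[OF assms(1), of j k i] less_row_count_iff[OF assms(2), of j k i] v assms(3)
    by (simp add: ij)
  then show "T v = T' v" by (metis lessI less_antisym less_irrefl)
qed (use assms in \<open>auto simp: semistandard_tableaux_def\<close>)

text \<open>
  If the entries other than \<open>x\<close> and \<open>x + 1\<close> are kept, the number of entries at most \<open>x\<close> in row \<open>i\<close> can
  take exactly the values between \<open>bk_lower\<close> and \<open>bk_upper\<close>, by interlacing, independently of the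
  other rows.  The involution reflects this number in its interval.  The first row has no row
  above it to bound it.
\<close>

definition bk_lower :: "nat multiset \<Rightarrow> nat \<Rightarrow> (nat \<times> nat \<Rightarrow> nat) \<Rightarrow> nat \<Rightarrow> nat" where
  "bk_lower \<mu> x T i = max (row_count \<mu> T x i) (row_count \<mu> T (Suc (Suc x)) (Suc i))"

definition bk_upper :: "nat multiset \<Rightarrow> nat \<Rightarrow> (nat \<times> nat \<Rightarrow> nat) \<Rightarrow> nat \<Rightarrow> nat" where
  "bk_upper \<mu> x T i = (case i of 0 \<Rightarrow> row_count \<mu> T (Suc (Suc x)) 0
     | Suc i' \<Rightarrow> min (row_count \<mu> T (Suc (Suc x)) i) (row_count \<mu> T x i'))"

definition bk_count :: "nat multiset \<Rightarrow> nat \<Rightarrow> (nat \<times> nat \<Rightarrow> nat) \<Rightarrow> nat \<Rightarrow> nat" where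
  "bk_count \<mu> x T i = bk_lower \<mu> x T i + bk_upper \<mu> x T i - row_count \<mu> T (Suc x) i"

definition bender_knuth :: "nat multiset \<Rightarrow> nat \<Rightarrow> (nat \<times> nat \<Rightarrow> nat) \<Rightarrow> nat \<times> nat \<Rightarrow> nat" where
  "bender_knuth \<mu> x T = (\<lambda>(i, j)\<in>diagram \<mu>.
     if T (i, j) \<in> {x, Suc x} then if j < bk_count \<mu> x T i then x else Suc x else T (i, j))"

lemma row_count_between:
  assumes "T \<in> semistandard_tableaux \<mu>"
  shows "bk_lower \<mu> x T i \<le> row_count \<mu> T (Suc x) i" "row_count \<mu> T (Suc x) i \<le> bk_upper \<mu> x T i"
  using row_count_mono[OF assms, of x "Suc x"] row_count_mono[OF assms, of "Suc x" "Suc (Suc x)"]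
    row_count_Suc_le[OF assms]
  by (auto simp: bk_lower_def bk_upper_def split: nat.split)

lemma bk_count_between:
  assumes "T \<in> semistandard_tableaux \<mu>"
  shows "bk_lower \<mu> x T i \<le> bk_count \<mu> x T i" "bk_count \<mu> x T i \<le> bk_upper \<mu> x T i"
  using row_count_between[OF assms, of x i] by (auto simp: bk_count_def)

lemma bk_count_le: "T \<in> semistandard_tableaux \<mu> \<Longrightarrow> bk_count \<mu> x T i \<le> row_count \<mu> T (Suc (Suc x)) i"
  using bk_count_between(2)[of T \<mu> x i] by (auto simp: bk_upper_def split: nat.splits)

text \<open>
  The involution changes the pattern only at the bound \<open>x + 1\<close>.  The reflected number lies between the
  numbers at the bounds \<open>x\<close> and \<open>x + 2\<close>, which makes the new entries consistent with the unchanged ones.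
\<close>

lemma bender_knuth_less_iff:
  assumes T: "T \<in> semistandard_tableaux \<mu>" and v: "(i, j) \<in> diagram \<mu>"
  shows "bender_knuth \<mu> x T (i, j) < k \<longleftrightarrow> j < ((row_count \<mu> T)(Suc x := bk_count \<mu> x T)) k i"
proof -
  have ge: "T (i, j) < x \<Longrightarrow> j < bk_count \<mu> x T i"
    using bk_count_between(1)[OF T, of x i] less_row_count_iff[OF T, of j x i] v by (simp add: bk_lower_def)
  have le: "j < bk_count \<mu> x T i \<Longrightarrow> T (i, j) < Suc (Suc x)"
    using bk_count_le[OF T, of x i] less_row_count_iff[OF T, of j "Suc (Suc x)" i] by simp
  have other: "j < row_count \<mu> T k i \<longleftrightarrow> T (i, j) < k" using less_row_count_iff[OF T] v by simp
  show ?thesis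
  proof (cases "k = Suc x")
    case True
    then show ?thesis using ge le v by (auto simp: bender_knuth_def)
  next
    case False
    then show ?thesis using v by (auto simp: bender_knuth_def other)
  qed
qed

lemma bender_knuth_tableau:
  assumes T: "T \<in> semistandard_tableaux \<mu>"
  shows "bender_knuth \<mu> x T \<in> semistandard_tableaux \<mu>"
proof (rule semistandard_tableauxI[OF _ bender_knuth_less_iff[OF T]])
  show "bender_knuth \<mu> x T \<in> extensional (diagram \<mu>)" by (simp add: bender_knuth_def)
  show "((row_count \<mu> T)(Suc x := bk_count \<mu> x T)) (Suc k) (Suc i)
      \<le> ((row_count \<mu> T)(Suc x := bk_count \<mu> x T)) k i" for i k
    using row_count_Suc_le[OF T] bk_count_between(1)[OF T, of x i] bk_count_between(2)[OF T, of x "Suc i"]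
    by (auto simp: bk_lower_def bk_upper_def)
qed

lemma row_count_bender_knuth:
  assumes T: "T \<in> semistandard_tableaux \<mu>"
  shows "row_count \<mu> (bender_knuth \<mu> x T) = (row_count \<mu> T)(Suc x := bk_count \<mu> x T)"
proof (intro ext)
  fix k i
  let ?C = "((row_count \<mu> T)(Suc x := bk_count \<mu> x T)) k i"
  \<comment> \<open>The columns below \<open>?C\<close> have entries in \<open>T\<close> less than \<open>k\<close> or \<open>x + 2\<close>, so they lie in the diagram; a
    common bound above both serves for either branch of the update.\<close>
  have "?C \<le> row_count \<mu> T (Suc (k + Suc x)) i"
    using bk_count_le[OF T, of x i] row_count_mono[OF T, of "Suc (Suc x)" "Suc (k + Suc x)" i]
      row_count_mono[OF T, of k "Suc (k + Suc x)" i] by auto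
  then have "j < ?C \<Longrightarrow> (i, j) \<in> diagram \<mu>" for j
    using less_row_count_iff[OF T] by (meson order_less_le_trans)
  then have "{j. (i, j) \<in> diagram \<mu> \<and> bender_knuth \<mu> x T (i, j) < k} = {..<?C}"
    using bender_knuth_less_iff[OF T] by auto
  then show "row_count \<mu> (bender_knuth \<mu> x T) k i = ?C" by (simp add: row_count_def)
qed

lemma bender_knuth_involution:
  assumes T: "T \<in> semistandard_tableaux \<mu>"
  shows "bender_knuth \<mu> x (bender_knuth \<mu> x T) = T"
proof (rule tableau_eqI[OF bender_knuth_tableau[OF bender_knuth_tableau[OF T]] T])
  let ?T = "bender_knuth \<mu> x T"
  have "bk_lower \<mu> x ?T = bk_lower \<mu> x T" "bk_upper \<mu> x ?T = bk_upper \<mu> x T"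
    by (auto simp: fun_eq_iff bk_lower_def bk_upper_def row_count_bender_knuth[OF T] split: nat.split)
  then have "bk_count \<mu> x ?T i = row_count \<mu> T (Suc x) i" for i
    using row_count_between[OF T, of x i]
    by (auto simp: bk_count_def[of _ _ ?T] row_count_bender_knuth[OF T] bk_count_def[of _ _ T])
  then show "row_count \<mu> (bender_knuth \<mu> x ?T) = row_count \<mu> T"
    by (auto simp: fun_eq_iff row_count_bender_knuth[OF bender_knuth_tableau[OF T]] row_count_bender_knuth[OF T])
qed

text \<open>
  The bounds telescope: the lower bound of row \<open>i\<close> and the upper bound of row \<open>i + 1\<close> are the maximum
  and the minimum of the same two numbers, so they can be replaced by these numbers.  The row
  below the diagram is included in the sums so that the last lower bound vanishes.
\<close>

lemma sum_bk_count:
  assumes T: "T \<in> semistandard_tableaux \<mu>"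
  shows "(\<Sum>i\<le>size \<mu>. bk_count \<mu> x T i) + (\<Sum>i\<le>size \<mu>. row_count \<mu> T (Suc x) i)
       = (\<Sum>i\<le>size \<mu>. row_count \<mu> T x i) + (\<Sum>i\<le>size \<mu>. row_count \<mu> T (Suc (Suc x)) i)"
proof -
  let ?a = "row_count \<mu> T x" and ?b = "row_count \<mu> T (Suc (Suc x))"
  have tele: "(\<Sum>i\<le>n. bk_lower \<mu> x T i + bk_upper \<mu> x T i)
      = (\<Sum>i<n. ?a i) + (\<Sum>i\<le>n. ?b i) + bk_lower \<mu> x T n" for n
  proof (induction n)
    case (Suc n)
    have "bk_lower \<mu> x T n + bk_upper \<mu> x T (Suc n) = ?a n + ?b (Suc n)"
      by (simp add: bk_lower_def bk_upper_def)
    with Suc show ?case by simp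
  qed (simp add: bk_upper_def)
  have "bk_count \<mu> x T i + row_count \<mu> T (Suc x) i = bk_lower \<mu> x T i + bk_upper \<mu> x T i" for i
    using row_count_between[OF T, of x i] by (simp add: bk_count_def)
  then have "(\<Sum>i\<le>size \<mu>. bk_count \<mu> x T i) + (\<Sum>i\<le>size \<mu>. row_count \<mu> T (Suc x) i)
      = (\<Sum>i\<le>size \<mu>. bk_lower \<mu> x T i + bk_upper \<mu> x T i)"
    by (simp flip: sum.distrib)
  also have "\<dots> = (\<Sum>i\<le>size \<mu>. ?a i) + (\<Sum>i\<le>size \<mu>. ?b i)"
    unfolding tele by (simp add: bk_lower_def row_count_outside lessThan_Suc_atMost[symmetric])
  finally show ?thesis .
qed

lemma sum_row_count: "(\<Sum>i\<le>size \<mu>. row_count \<mu> T k i) = card {v \<in> diagram \<mu>. T v < k}"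
proof -
  have "{v \<in> diagram \<mu>. T v < k} = (SIGMA i:{..size \<mu>}. {j. (i, j) \<in> diagram \<mu> \<and> T (i, j) < k})"
    by (auto simp: diagram_def)
  moreover have "finite {j. (i, j) \<in> diagram \<mu> \<and> T (i, j) < k}" for i
    by (rule finite_subset[of _ "{..<parts \<mu> ! i}"]) (auto simp: diagram_def)
  ultimately show ?thesis by (simp add: row_count_def)
qed

text \<open>
  The multiplicity of an entry \<open>k\<close> is the difference of the sizes of two consecutive shapes of the
  pattern, written without subtraction.
\<close>

lemma count_tableau:
  "count (colour_monomial (diagram \<mu>) T) k + (\<Sum>i\<le>size \<mu>. row_count \<mu> T k i)
     = (\<Sum>i\<le>size \<mu>. row_count \<mu> T (Suc k) i)"
proof -
  have "{v \<in> diagram \<mu>. T v < Suc k} = {v \<in> diagram \<mu>. T v = k} \<union> {v \<in> diagram \<mu>. T v < k}" by auto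
  moreover have "card \<dots> = card {v \<in> diagram \<mu>. T v = k} + card {v \<in> diagram \<mu>. T v < k}"
    by (rule card_Un_disjoint) (auto simp: finite_diagram)
  moreover have "count (colour_monomial (diagram \<mu>) T) k = card {v \<in> diagram \<mu>. T v = k}"
    by (simp add: colour_monomial_def count_image_mset finite_diagram vimage_def Int_def conj_commute)
  ultimately show ?thesis by (simp add: sum_row_count)
qed

text \<open>
  By \<open>sum_bk_count\<close> the sizes of the shapes at \<open>x\<close>, \<open>x + 1\<close>, \<open>x + 2\<close> change from \<open>a, b, c\<close> to
  \<open>a, a + c - b, c\<close>, which exchanges the differences \<open>b - a\<close> and \<open>c - b\<close>.
\<close>

lemma colour_monomial_bender_knuth:
  assumes T: "T \<in> semistandard_tableaux \<mu>"
  shows "colour_monomial (diagram \<mu>) (bender_knuth \<mu> x T)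
       = image_mset (transpose x (Suc x)) (colour_monomial (diagram \<mu>) T)"
proof (rule multiset_eqI)
  fix k
  let ?w = "colour_monomial (diagram \<mu>)"
  have vimage: "transpose x (Suc x) -` {k} = {transpose x (Suc x) k}"
    by (auto simp: transpose_eq_iff)
  have rhs: "count (image_mset (transpose x (Suc x)) (?w T)) k = count (?w T) (transpose x (Suc x) k)"
    by (auto simp: count_image_mset vimage Int_insert_left not_in_iff)
  note cT = count_tableau[of \<mu> T] and cB = count_tableau[of \<mu> "bender_knuth \<mu> x T"]
  consider "k = x" | "k = Suc x" | "k \<noteq> x" "k \<noteq> Suc x" by blast
  then show "count (?w (bender_knuth \<mu> x T)) k = count (image_mset (transpose x (Suc x)) (?w T)) k"
    unfolding rhs
  proof cases
    case 1
    then show "count (?w (bender_knuth \<mu> x T)) k = count (?w T) (transpose x (Suc x) k)"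
      using cB[of x] cT[of "Suc x"] sum_bk_count[OF T, of x] by (simp add: row_count_bender_knuth[OF T])
  next
    case 2
    then show "count (?w (bender_knuth \<mu> x T)) k = count (?w T) (transpose x (Suc x) k)"
      using cB[of "Suc x"] cT[of x] sum_bk_count[OF T, of x] by (simp add: row_count_bender_knuth[OF T])
  next
    case 3
    then show "count (?w (bender_knuth \<mu> x T)) k = count (?w T) (transpose x (Suc x) k)"
      using cB[of k] cT[of k] by (simp add: row_count_bender_knuth[OF T])
  qed
qed

lemma schur_adjacent_transposition:
  "schur \<mu> (image_mset (transpose x (Suc x)) M) = schur \<mu> M"
proof -
  let ?s = "transpose x (Suc x)" and ?w = "colour_monomial (diagram \<mu>)"
  let ?A = "semistandard_tableaux \<mu>"
  have inv: "image_mset ?s (image_mset ?s M) = M" for M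
    by (simp add: image_mset.compositionality)
  have "bij_betw (bender_knuth \<mu> x) {T \<in> ?A. ?w T = M} {T \<in> ?A. ?w T = image_mset ?s M}"
    by (rule bij_betw_byWitness[where f' = "bender_knuth \<mu> x"])
      (auto simp: bender_knuth_involution bender_knuth_tableau colour_monomial_bender_knuth inv)
  from bij_betw_same_card[OF this] show ?thesis
    by (simp add: schur_def monomial_sum_def colour_monomial_def)
qed

text \<open>Adjacent transpositions generate all permutations of finite support.\<close>

lemma invariant_under_permutes:
  fixes g :: series
  assumes adj: "\<And>x M. g (image_mset (transpose x (Suc x)) M) = g M"
    and p: "p permutes A" "finite A"
  shows "g (image_mset p M) = g M"
proof -
  have less: "g (image_mset (transpose a b) M) = g M" if "a < b" for a b M
    using that
  proof (induction b arbitrary: M)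
    case (Suc b)
    show ?case
    proof (cases "a = b")
      case False
      with Suc.prems have ab: "a < b" by simp
      have "transpose a (Suc b) = transpose b (Suc b) \<circ> transpose a b \<circ> transpose b (Suc b)"
        using ab by (auto simp: fun_eq_iff transpose_def)
      then have "image_mset (transpose a (Suc b)) M
          = image_mset (transpose b (Suc b)) (image_mset (transpose a b) (image_mset (transpose b (Suc b)) M))"
        by (simp add: image_mset.compositionality comp_assoc)
      then show ?thesis using adj Suc.IH[OF ab] by simp
    qed (use adj in simp)
  qed simp
  have transp: "g (image_mset (transpose a b) M) = g M" for a b M
    using less[of a b M] less[of b a M] by (cases a b rule: linorder_cases) (auto simp: transpose_commute)
  show ?thesis using p
  proof (induction arbitrary: M rule: permutes_induct)
    case (swap a b p)
    have "image_mset (transpose a b \<circ> p) M = image_mset (transpose a b) (image_mset p M)"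
      by (simp add: image_mset.compositionality)
    then have "g (image_mset (transpose a b \<circ> p) M) = g (image_mset p M)"
      by (simp only: transp)
    also have "\<dots> = g M" by (rule swap)
    finally show ?case .
  qed simp
qed

theorem symmetrization_schur: "symmetrization (schur \<mu>) = schur \<mu>"
proof (rule symmetrization_eq_self)
  fix M M' :: "nat multiset"
  assume "exponents M = exponents M'"
  then obtain p where "p permutes (set_mset M \<union> set_mset M')" "image_mset p M = M'"
    by (rule ex_permutes_of_exponents_eq)
  then show "schur \<mu> M = schur \<mu> M'"
    using invariant_under_permutes[of "schur \<mu>", OF schur_adjacent_transposition] by fastforce
qed

section \<open>Positivity in the \<open>\<Xi>\<close>\<close>

theorem corollary3:
  shows "(\<forall>g. symmetric_function g \<and> Q_positive g \<longrightarrow> Xi_positive g) \<and>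
         (\<forall>G :: 'a pair_pre_digraph. pair_graph G \<longrightarrow> Xi_positive (chromatic_sf G)) \<and>
         (\<forall>\<mu>\<in>int_partitions. Xi_positive (schur \<mu>))"
proof (intro conjI allI impI ballI)
  fix g assume "symmetric_function g \<and> Q_positive g"
  then show "Xi_positive g"
    using Xi_positive_symmetrization[of g] symmetrization_symmetric_function[of g] by simp
next
  fix G :: "'a pair_pre_digraph" assume G: "pair_graph G"
  then show "Xi_positive (chromatic_sf G)"
    unfolding chromatic_sf_eq_symmetrization[OF G]
    by (intro Xi_positive_symmetrization Q_positive_proper_colourings)
next
  fix \<mu>
  show "Xi_positive (schur \<mu>)"
    using Xi_positive_symmetrization[OF Q_positive_schur, of \<mu>] by (simp add: symmetrization_schur)
qed

end
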